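(* Let $\mathbb{T}$ be a time scale. Let $\nu:[a,b]\to[0,\infty)$ be $rd$-continuous and positive, and let $w:[a,b]\to\mathbb{R}$ be delta-differentiable such that $w^{\Delta}(t)=\nu(t)$ on $[a,b]$. Suppose also that $a,b,t,x\in\mathbb{T}$, $a<b$, $f:[a,b]\to\mathbb{R}$ is delta-differentiable, and $\psi$ is a function of $[0,1]$ into $[0,1]$. For $\lambda\in[0,1]$ put $$K(s,t)=\begin{cases} w(s)-\left(w(a)+\psi(\lambda)\frac{w(b)-w(a)}{2}\right), & s\in[a,t),\\ w(s)-\left(w(a)+(1+\psi(1-\lambda))\frac{w(b)-w(a)}{2}\right), & s\in[t,b].\end{cases}$$ Then the inequality $$\begin{aligned} &\Bigg|\left[\frac{1+\psi(1-\lambda)-\psi(\lambda)}{2(b-a)}f(x)+\frac{\psi(\lambda)f(a)+(1-\psi(1-\lambda))f(b)}{2(b-a)}\right]\int_a^b\nu(t)\Delta t\\ &\quad-\frac{1}{b-a}\int_a^b\nu(t)f(\sigma(t))\Delta t-\left(\frac{f(b)-f(a)}{(b-a)^2}\int_a^bK(t,x)\Delta t\right)\Bigg|\\ &\le\left[\frac{1}{b-a}\int_a^bK^2(t,x)\Delta t-\left(\frac{1}{b-a}\int_a^bK(t,x)\Delta t\right)^2\right]^{1/2}\\ &\quad\times\left[\frac{1}{b-a}\int_a^b\left(f^{\Delta}(t)\right)^2\Delta t-\left(\frac{1}{b-a}\int_a^bf^{\Delta}(t)\Delta t\right)^2\right]^{1/2} \end{aligned}$$ holds for all $x\in[a,b]$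 and $\lambda\in[0,1]$.
   Context: A time scale $\mathbb{T}$ is an arbitrary nonempty closed subset of $\mathbb{R}$, with the topology inherited from the standard topology on $\mathbb{R}$; for points $a<b$ in $\mathbb{T}$, $[a,b]$ denotes $\{t\in\mathbb{T}: a\le t\le b\}$ (similarly for half-open intervals). The forward and backward jump operators $\sigma,\rho:\mathbb{T}\to\mathbb{T}$ are $\sigma(t)=\inf\{s\in\mathbb{T}:s>t\}$ and $\rho(t)=\sup\{s\in\mathbb{T}:s<t\}$. A point $t$ is right-dense if $\sigma(t)=t$, left-dense if $\rho(t)=t$, and left-scattered if $\rho(t)<t$. $\mathbb{T}^{\kappa}=\mathbb{T}\setminus\{m\}$ if $\mathbb{T}$ has a left-scattered maximum $m$, and $\mathbb{T}^{\kappa}=\mathbb{T}$ otherwise. The (delta) derivative $f^{\Delta}(t)$ of $f:\mathbb{T}\to\mathbb{R}$ at $t\in\mathbb{T}^{\kappa}$ is the number (provided it exists) such that for every $\epsilon>0$ there is a neighborhood $U$ of $t$ with $|f(\sigma(t))-f(s)-f^{\Delta}(t)[\sigma(t)-s]|\le\epsilon|\sigma(t)-s|$ for all $s\in U$. A function $f:\mathbb{T}\to\mathbb{R}$ is $rd$-continuous if it is continuous at all right-dense points of $\mathbb{T}$ and its left-sided limits exist at all left-dense points of $\mathbb{T}$. A function $F:\mathbb{T}\to\mathbb{R}$ is a delta anti-derivative of $f:\mathbb{T}\to\mathbb{R}$ if $F^{\Delta}(t)=f(t)$ for any $t\in\mathbb{T}^{\kappa}$; in this case the $\Delta$-integral of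 $f$ is defined by $\int_a^bf(s)\Delta s:=F(b)-F(a)$ for all $a,b\in\mathbb{T}$. Every $rd$-continuous function has a delta anti-derivative.
   Formalization: The Δ-integral of (f^Δ)², which need not exist for a merely delta-differentiable f, is assumed to exist; Δ-integrals are taken via continuous F with F^Δ = f off a countable set of right-dense points, since K(·,x) may have no delta anti-derivative. *)

theory Defs
  imports "HOL-Analysis.Analysis"
begin

definition time_scale :: "real set \<Rightarrow> bool" where
  "time_scale T \<longleftrightarrow> T \<noteq> {} \<and> closed T"

text \<open>The jump operators follow the usual conventions \<open>inf {} = sup T\<close> and
  \<open>sup {} = inf T\<close>: they fix a maximum and a minimum of \<open>T\<close>, respectively.\<close>

definition fwd_jump :: "real set \<Rightarrow> real \<Rightarrow> real" where
  "fwd_jump T t = (if \<exists>s\<in>T. t < s then Inf {s\<in>T. t < s} else t)"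

definition bwd_jump :: "real set \<Rightarrow> real \<Rightarrow> real" where
  "bwd_jump T t = (if \<exists>s\<in>T. s < t then Sup {s\<in>T. s < t} else t)"

definition ts_kappa :: "real set \<Rightarrow> real set" where
  "ts_kappa T = {t\<in>T. \<not> ((\<forall>s\<in>T. s \<le> t) \<and> bwd_jump T t < t)}"

definition has_delta_derivative :: "real set \<Rightarrow> (real \<Rightarrow> real) \<Rightarrow> real \<Rightarrow> real \<Rightarrow> bool" where
  "has_delta_derivative T f D t \<longleftrightarrow>
     (\<forall>\<epsilon>>0. \<exists>U. open U \<and> t \<in> U \<and>
        (\<forall>s\<in>U \<inter> T. \<bar>f (fwd_jump T t) - f s - D * (fwd_jump T t - s)\<bar>
                    \<le> \<epsilon> * \<bar>fwd_jump T t - s\<bar>))"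

definition delta_differentiable :: "real set \<Rightarrow> (real \<Rightarrow> real) \<Rightarrow> bool" where
  "delta_differentiable T f \<longleftrightarrow> (\<forall>t\<in>ts_kappa T. \<exists>D. has_delta_derivative T f D t)"

definition delta_deriv :: "real set \<Rightarrow> (real \<Rightarrow> real) \<Rightarrow> real \<Rightarrow> real" where
  "delta_deriv T f t = (THE D. has_delta_derivative T f D t)"

definition rd_continuous :: "real set \<Rightarrow> (real \<Rightarrow> real) \<Rightarrow> bool" where
  "rd_continuous T f \<longleftrightarrow>
     (\<forall>t\<in>T. fwd_jump T t = t \<longrightarrow> continuous (at t within T) f) \<and>
     (\<forall>t\<in>T. bwd_jump T t = t \<longrightarrow> (\<exists>l. (f \<longlongrightarrow> l) (at t within (T \<inter> {..<t}))))"

definition delta_antiderivative :: "real set \<Rightarrow> (real \<Rightarrow> real) \<Rightarrow> (real \<Rightarrow> real) \<Rightarrow> bool" where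
  "delta_antiderivative T f F \<longleftrightarrow> (\<forall>t\<in>ts_kappa T. has_delta_derivative T F (f t) t)"

text \<open>A function with a jump at a point that is both left-dense and right-dense has no delta
  antiderivative, by the Darboux property of derivatives; the kernel defined below is such a
  function in general.  The integral is therefore taken, as is standard in the time scales
  calculus, with respect to pre-antiderivatives: \<open>F\<close> is continuous and \<open>F\<close> has delta
  derivative \<open>f\<close> outside a countable set without right-scattered points.  Lemma
  \<open>delta_integral_antiderivative\<close> shows that this extends \<open>F b - F a\<close> for
  delta antiderivatives \<open>F\<close>.\<close>

definition delta_pre_antiderivative :: "real set \<Rightarrow> (real \<Rightarrow> real) \<Rightarrow> (real \<Rightarrow> real) \<Rightarrow> bool" where
  "delta_pre_antiderivative T f F \<longleftrightarrow>
     continuous_on T F \<and>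
     (\<exists>N. countable N \<and> (\<forall>t\<in>N. fwd_jump T t = t) \<and>
          (\<forall>t\<in>ts_kappa T - N. has_delta_derivative T F (f t) t))"

definition delta_integrable :: "real set \<Rightarrow> (real \<Rightarrow> real) \<Rightarrow> bool" where
  "delta_integrable T f \<longleftrightarrow> (\<exists>F. delta_pre_antiderivative T f F)"

definition delta_integral :: "real set \<Rightarrow> real \<Rightarrow> real \<Rightarrow> (real \<Rightarrow> real) \<Rightarrow> real" where
  "delta_integral T a b f = (THE I. \<exists>F. delta_pre_antiderivative T f F \<and> I = F b - F a)"

definition kernel_K ::
  "(real \<Rightarrow> real) \<Rightarrow> (real \<Rightarrow> real) \<Rightarrow> real \<Rightarrow> real \<Rightarrow> real \<Rightarrow> real \<Rightarrow> real \<Rightarrow> real" where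
  "kernel_K w \<psi> a b lam s t =
     (if s < t then w s - (w a + \<psi> lam * ((w b - w a) / 2))
      else w s - (w a + (1 + \<psi> (1 - lam)) * ((w b - w a) / 2)))"

lemma fwd_jump_ge: "t \<le> fwd_jump T t"
  unfolding fwd_jump_def by (auto intro!: cInf_greatest)

lemma fwd_jump_le: "s \<in> T \<Longrightarrow> t < s \<Longrightarrow> fwd_jump T t \<le> s"
  unfolding fwd_jump_def by (auto intro!: cInf_lower bdd_belowI[of _ t])

lemma fwd_jump_in:
  assumes "closed T" "t \<in> T"
  shows "fwd_jump T t \<in> T"
proof (cases "\<exists>s\<in>T. t < s")
  case True
  define S where "S = {s\<in>T. t < s}"
  have "bdd_below S" "S \<noteq> {}"
    using True by (auto simp: S_def intro!: bdd_belowI[of _ t])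
  then have "Inf S \<in> closure S"
    using closure_contains_Inf by blast
  moreover have "closure S \<subseteq> T"
    using assms(1) by (intro closure_minimal) (simp_all add: S_def)
  ultimately have "Inf S \<in> T" by blast
  then show ?thesis
    using True by (simp add: fwd_jump_def S_def)
next
  case False
  then have "fwd_jump T t = t" unfolding fwd_jump_def by (rule if_not_P)
  then show ?thesis using assms(2) by simp
qed

lemma has_delta_derivativeE:
  assumes "has_delta_derivative T f D t" "\<epsilon> > 0"
  obtains U where "open U" "t \<in> U"
    "\<And>s. s \<in> U \<inter> T \<Longrightarrow> \<bar>f (fwd_jump T t) - f s - D * (fwd_jump T t - s)\<bar>
                    \<le> \<epsilon> * \<bar>fwd_jump T t - s\<bar>"
proof -
  from assms have "\<exists>U. open U \<and> t \<in> U \<and>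
        (\<forall>s\<in>U \<inter> T. \<bar>f (fwd_jump T t) - f s - D * (fwd_jump T t - s)\<bar>
                    \<le> \<epsilon> * \<bar>fwd_jump T t - s\<bar>)"
    unfolding has_delta_derivative_def by (elim allE impE)
  then show thesis by (elim exE conjE) (rule that, assumption+, drule (1) bspec)
qed

lemma has_delta_derivative_continuous:
  assumes der: "has_delta_derivative T F D t" and t: "t \<in> T"
  shows "continuous (at t within T) F"
  unfolding continuous_within_eps_delta
proof (intro allI impI)
  fix e :: real assume e: "e > 0"
  define m where "m = fwd_jump T t - t"
  have m: "m \<ge> 0" by (simp add: m_def fwd_jump_ge)
  define \<epsilon> where "\<epsilon> = min 1 (e / (4 * (m + 1)))"
  have \<epsilon>: "\<epsilon> > 0" "\<epsilon> * (m + 1) \<le> e / 4"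
  proof -
    show "\<epsilon> > 0" using e m by (auto simp: \<epsilon>_def)
    have "\<epsilon> * (m + 1) \<le> e / (4 * (m + 1)) * (m + 1)"
      using m by (intro mult_right_mono) (auto simp: \<epsilon>_def)
    also have "\<dots> = e / 4" using m by (simp add: field_simps)
    finally show "\<epsilon> * (m + 1) \<le> e / 4" .
  qed
  obtain U where U: "open U" "t \<in> U" and
    UB: "\<And>s. s \<in> U \<inter> T \<Longrightarrow> \<bar>F (fwd_jump T t) - F s - D * (fwd_jump T t - s)\<bar>
            \<le> \<epsilon> * \<bar>fwd_jump T t - s\<bar>"
    by (rule has_delta_derivativeE[OF der \<epsilon>(1)]) (rule that)
  obtain d where d: "d > 0" "ball t d \<subseteq> U"
    using openE[OF U(1) U(2)] by blast
  define d' where "d' = min (min d 1) (e / (4 * (\<bar>D\<bar> + 1)))"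
  have d': "d' > 0" "d' \<le> d" "d' \<le> 1" "\<bar>D\<bar> * d' \<le> e / 4"
  proof -
    have pos: "4 * (\<bar>D\<bar> + 1) > 0"
      by (rule mult_pos_pos) simp_all
    show "d' > 0" "d' \<le> d" "d' \<le> 1"
      using d(1) divide_pos_pos[OF e pos] unfolding d'_def by linarith+
    then have "\<bar>D\<bar> * d' \<le> (\<bar>D\<bar> + 1) * d'"
      by (intro mult_right_mono) simp_all
    also have "\<dots> \<le> (\<bar>D\<bar> + 1) * (e / (4 * (\<bar>D\<bar> + 1)))"
      unfolding d'_def by (rule mult_left_mono) linarith+
    also have "\<dots> = e / 4"
    proof -
      have "y * (e / (4 * y)) = e / 4" if "y > 0" for y :: real
        using that by simp
      from this[of "\<bar>D\<bar> + 1"] show ?thesis by linarith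
    qed
    finally show "\<bar>D\<bar> * d' \<le> e / 4" .
  qed
  have "\<bar>F s - F t\<bar> < e" if s: "s \<in> T" "\<bar>s - t\<bar> < d'" for s
  proof -
    have "s \<in> ball t d" using d'(2) s(2) by (simp add: dist_real_def abs_minus_commute)
    then have "s \<in> U" using d(2) by blast
    then have "\<bar>F (fwd_jump T t) - F s - D * (fwd_jump T t - s)\<bar> \<le> \<epsilon> * \<bar>fwd_jump T t - s\<bar>"
      using UB s by auto
    also have "\<bar>fwd_jump T t - s\<bar> \<le> m + 1"
      using s(2) d'(3) m unfolding m_def by linarith
    then have "\<epsilon> * \<bar>fwd_jump T t - s\<bar> \<le> \<epsilon> * (m + 1)"
      using \<epsilon>(1) by (intro mult_left_mono) simp_all
    finally have 1: "\<bar>F (fwd_jump T t) - F s - D * (fwd_jump T t - s)\<bar> \<le> e / 4"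
      using \<epsilon>(2) by linarith
    have "\<bar>F (fwd_jump T t) - F t - D * (fwd_jump T t - t)\<bar> \<le> \<epsilon> * \<bar>m\<bar>"
      using UB[of t] U t by (auto simp: m_def)
    also have "\<dots> \<le> \<epsilon> * (m + 1)"
      using \<epsilon>(1) m by (intro mult_left_mono) auto
    finally have 2: "\<bar>F (fwd_jump T t) - F t - D * (fwd_jump T t - t)\<bar> \<le> e / 4"
      using \<epsilon>(2) by linarith
    have "\<bar>D * (s - t)\<bar> \<le> \<bar>D\<bar> * d'"
      using s by (auto simp: abs_mult intro!: mult_left_mono)
    then have 3: "\<bar>D * (s - t)\<bar> \<le> e / 4"
      using d'(4) by linarith
    have "F s - F t = (F (fwd_jump T t) - F t - D * (fwd_jump T t - t))
        - (F (fwd_jump T t) - F s - D * (fwd_jump T t - s)) + D * (s - t)"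
      by (simp add: algebra_simps)
    then show ?thesis using 1 2 3 e by linarith
  qed
  then show "\<exists>d>0. \<forall>x'\<in>T. dist x' t < d \<longrightarrow> dist (F x') (F t) < e"
    using d'(1) by (auto simp: dist_real_def)
qed

lemma delta_antiderivative_imp_pre:
  assumes "delta_antiderivative T f F"
  shows "delta_pre_antiderivative T f F"
proof -
  have "continuous (at t within T) F" if t: "t \<in> T" for t
  proof (cases "t \<in> ts_kappa T")
    case True
    then show ?thesis
      using assms t has_delta_derivative_continuous unfolding delta_antiderivative_def by blast
  next
    case False
    then have max: "\<forall>s\<in>T. s \<le> t" and ls: "bwd_jump T t < t"
      using t by (auto simp: ts_kappa_def)
    have "s \<le> bwd_jump T t" if "s \<in> T" "s \<noteq> t" for s
    proof -
      have "s < t" using max that by force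
      then show ?thesis
        using that unfolding bwd_jump_def by (auto intro!: cSup_upper bdd_aboveI[of _ t])
    qed
    then have "\<not> t islimpt T"
      using ls unfolding islimpt_def
      by (intro notI) (metis greaterThan_iff linorder_not_le open_greaterThan)
    then show ?thesis
      using trivial_limit_within[of t T] by (simp add: continuous_within)
  qed
  then have "continuous_on T F"
    by (simp add: continuous_on_eq_continuous_within)
  then show ?thesis
    using assms unfolding delta_pre_antiderivative_def delta_antiderivative_def
    by (intro conjI exI[of _ "{}"]) auto
qed

lemma delta_derivative_zero_imp_const:
  fixes G :: "real \<Rightarrow> real"
  assumes T: "closed T" and ab: "a \<in> T" "b \<in> T" "a \<le> b"
    and cont: "continuous_on T G"
    and N: "countable N" "\<And>t. t \<in> N \<Longrightarrow> fwd_jump T t = t"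
    and der: "\<And>t. t \<in> ts_kappa T - N \<Longrightarrow> has_delta_derivative T G 0 t"
  shows "G b = G a"
proof -
  obtain e :: "nat \<Rightarrow> real" where e: "N \<subseteq> range e"
    using N(1) by (metis empty_subsetI from_nat_into_surj rangeI subsetI)
  define \<phi> where "\<phi> t = (\<Sum>k. if e k < t then (1/2)^k else (0::real))" for t
  have summ: "summable (\<lambda>k. if e k < t then (1/2)^k else (0::real))" for t
    by (rule summable_comparison_test'[OF summable_geometric[of "1/2::real"], of 0]) auto
  have \<phi>0: "\<phi> t \<ge> 0" for t
    unfolding \<phi>_def by (intro suminf_nonneg summ) auto
  have \<phi>mono: "\<phi> s \<le> \<phi> t" if "s \<le> t" for s t
    unfolding \<phi>_def using that by (intro suminf_le summ) auto
  have \<phi>jump: "\<phi> (e k) + (1/2)^k \<le> \<phi> s" if "e k < s" for k s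
  proof -
    have "\<phi> (e k) + (1/2)^k
        = (\<Sum>j. (if e j < e k then (1/2)^j else 0) + (if j = k then (1/2)^j else (0::real)))"
      unfolding \<phi>_def
      using suminf_add[OF summ[of "e k"] sums_summable[OF sums_single[of k "\<lambda>j. (1/2)^j::real"]]]
        sums_unique[OF sums_single[of k "\<lambda>j. (1/2)^j::real"]] by simp
    also have "\<dots> \<le> \<phi> s"
      unfolding \<phi>_def
      by (intro suminf_le summ summable_add sums_summable[OF sums_single]) (use that in auto)
    finally show ?thesis .
  qed
  have main: "\<bar>G b - G a\<bar> \<le> \<epsilon> * ((b - a) + \<phi> b)" if \<epsilon>: "\<epsilon> > 0" for \<epsilon>
  proof -
    define P where "P t \<longleftrightarrow> \<bar>G t - G a\<bar> \<le> \<epsilon> * ((t - a) + \<phi> t)" for t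
    define A where "A = {t \<in> T \<inter> {a..b}. \<forall>s\<in>T \<inter> {a..t}. P s}"
    have Pa: "P a" using \<phi>0[of a] \<epsilon> by (simp add: P_def)
    have aA: "a \<in> A" using Pa ab by (auto simp: A_def)
    have bdd: "bdd_above A" by (auto simp: A_def intro!: bdd_aboveI[of _ b])
    define c where "c = Sup A"
    have c_up: "t \<le> c" if "t \<in> A" for t using bdd that by (simp add: c_def cSup_upper)
    have ac: "a \<le> c" using c_up aA by blast
    have cb: "c \<le> b" unfolding c_def using aA by (intro cSup_least) (auto simp: A_def)
    have "c \<in> closure A"
      unfolding c_def using aA bdd by (intro closure_contains_Sup) auto
    moreover have "closure A \<subseteq> T"
      using T by (intro closure_minimal) (simp_all add: A_def subset_iff)
    ultimately have cT: "c \<in> T" by blast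
    have below: "P s" if s: "s \<in> T" "a \<le> s" "s < c" for s
    proof -
      obtain t where "t \<in> A" "s < t"
        using less_cSup_iff[of A s] s aA bdd unfolding c_def by blast
      then show ?thesis using s by (auto simp: A_def)
    qed
    have near: "\<exists>d>0. \<forall>s\<in>T. \<bar>s - c\<bar> < d \<longrightarrow> \<bar>G s - G c\<bar> < \<eta>" if "\<eta> > 0" for \<eta>
      using cont[unfolded continuous_on_iff dist_real_def, rule_format, OF cT that] by blast
    have Pc: "P c"
    proof (cases "c \<in> A")
      case True
      then show ?thesis using ac by (auto simp: A_def)
    next
      case False
      have "\<bar>G c - G a\<bar> \<le> \<epsilon> * ((c - a) + \<phi> c) + \<eta>" if \<eta>: "\<eta> > 0" for \<eta>
      proof -
        obtain d where d: "d > 0" "\<And>s. s \<in> T \<Longrightarrow> \<bar>s - c\<bar> < d \<Longrightarrow> \<bar>G s - G c\<bar> < \<eta>"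
          using near[OF \<eta>] by blast
        have "c - d < Sup A" using d(1) by (simp add: c_def)
        then obtain s where s: "s \<in> A" "c - d < s"
          using less_cSup_iff[of A "c - d"] aA bdd by blast
        have "s < c" using c_up[OF s(1)] False s(1) by (cases "s = c") auto
        have sT: "s \<in> T" "a \<le> s" using s(1) by (auto simp: A_def)
        have 1: "\<bar>G s - G c\<bar> < \<eta>" using d(2)[of s] s sT \<open>s < c\<close> by auto
        have "\<bar>G s - G a\<bar> \<le> \<epsilon> * ((s - a) + \<phi> s)"
          using below sT \<open>s < c\<close> by (auto simp: P_def)
        also have "\<dots> \<le> \<epsilon> * ((c - a) + \<phi> c)"
          using \<epsilon> \<open>s < c\<close> \<phi>mono[of s c] by (intro mult_left_mono) auto
        finally show ?thesis using 1 by linarith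
      qed
      then show ?thesis unfolding P_def by (rule field_le_epsilon)
    qed
    have "c = b"
    proof (rule ccontr)
      assume "c \<noteq> b"
      then have "c < b" using cb by simp
      then have ck: "c \<in> ts_kappa T" using cT ab by (force simp: ts_kappa_def)
      have ext: False if "u \<in> T" "c < u" "u \<le> b" "\<And>s. s \<in> T \<Longrightarrow> c < s \<Longrightarrow> s \<le> u \<Longrightarrow> P s" for u
      proof -
        have "P s" if "s \<in> T \<inter> {a..u}" for s
          using that \<open>\<And>s. s \<in> T \<Longrightarrow> c < s \<Longrightarrow> s \<le> u \<Longrightarrow> P s\<close> below[of s] Pc
          by (cases s c rule: linorder_cases) auto
        then have "u \<in> A" using that(1-3) ac by (auto simp: A_def)
        then show False using c_up[of u] that(2) by linarith
      qed
      have step: "P s" if "c < s" "\<bar>G s - G c\<bar> \<le> \<epsilon> * ((s - c) + (\<phi> s - \<phi> c))" for s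
      proof -
        have "\<bar>G s - G a\<bar> \<le> \<bar>G s - G c\<bar> + \<bar>G c - G a\<bar>" by linarith
        also have "\<dots> \<le> \<epsilon> * ((s - c) + (\<phi> s - \<phi> c)) + \<epsilon> * ((c - a) + \<phi> c)"
          using that Pc by (auto simp: P_def)
        finally show ?thesis by (simp add: P_def algebra_simps)
      qed
      have step': "P s" if "c < s" "\<bar>G s - G c\<bar> \<le> \<epsilon> * (s - c)" for s
      proof -
        have "\<epsilon> * (s - c) \<le> \<epsilon> * ((s - c) + (\<phi> s - \<phi> c))"
          using \<epsilon> \<phi>mono[of c s] that by (intro mult_left_mono) auto
        then show ?thesis using step that by auto
      qed
      have dense: "\<exists>u\<in>T. c < u \<and> u < c + d \<and> u \<le> b" if "fwd_jump T c = c" "d > 0" for d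
      proof -
        have "Inf {s\<in>T. c < s} < min (c + d) b"
          using that \<open>c < b\<close> ab by (auto simp: fwd_jump_def split: if_splits)
        moreover have "{s\<in>T. c < s} \<noteq> {}" "bdd_below {s\<in>T. c < s}"
          using \<open>c < b\<close> ab by (auto intro!: bdd_belowI[of _ c])
        ultimately obtain u where "u \<in> T" "c < u" "u < min (c + d) b"
          using cInf_less_iff[of "{s\<in>T. c < s}" "min (c + d) b"] by blast
        then show ?thesis by (intro bexI[of _ u]) auto
      qed
      show False
      proof (cases "c \<in> N")
        case True
        then obtain k where k: "c = e k" using e by auto
        obtain d where d: "d > 0" "\<And>s. s \<in> T \<Longrightarrow> \<bar>s - c\<bar> < d \<Longrightarrow> \<bar>G s - G c\<bar> < \<epsilon> * (1/2)^k"
          using near[of "\<epsilon> * (1/2)^k"] \<epsilon> by (metis half_gt_zero_iff zero_less_power mult_pos_pos zero_less_one)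
        obtain u where u: "u \<in> T" "c < u" "u < c + d" "u \<le> b"
          using dense[OF N(2)[OF True] d(1)] by blast
        have "P s" if s: "s \<in> T" "c < s" "s \<le> u" for s
        proof (rule step)
          have "\<bar>G s - G c\<bar> \<le> \<epsilon> * (1/2)^k" using d(2)[of s] s u by auto
          also have "\<dots> \<le> \<epsilon> * ((s - c) + (\<phi> s - \<phi> c))"
            using \<epsilon> \<phi>jump[of k s] s k by (intro mult_left_mono) auto
          finally show "\<bar>G s - G c\<bar> \<le> \<epsilon> * ((s - c) + (\<phi> s - \<phi> c))" .
        qed (use s in auto)
        then show False using ext u by blast
      next
        case False
        then have der_c: "has_delta_derivative T G 0 c" using der ck by blast
        obtain U where U: "open U" "c \<in> U" and
          UB0: "\<And>s. s \<in> U \<inter> T \<Longrightarrow> \<bar>G (fwd_jump T c) - G s - 0 * (fwd_jump T c - s)\<bar>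
            \<le> \<epsilon> * \<bar>fwd_jump T c - s\<bar>"
          by (rule has_delta_derivativeE[OF der_c \<epsilon>]) (rule that)
        have UB: "\<bar>G (fwd_jump T c) - G s\<bar> \<le> \<epsilon> * \<bar>fwd_jump T c - s\<bar>"
          if "s \<in> U \<inter> T" for s
          using UB0[OF that] by simp
        show False
        proof (cases "fwd_jump T c = c")
          case True
          obtain d where d: "d > 0" "ball c d \<subseteq> U" using openE[OF U(1) U(2)] by blast
          obtain u where u: "u \<in> T" "c < u" "u < c + d" "u \<le> b"
            using dense[OF True d(1)] by blast
          have "P s" if s: "s \<in> T" "c < s" "s \<le> u" for s
          proof (rule step')
            have "s \<in> U" using d s u by (auto simp: subset_iff dist_real_def)
            then show "\<bar>G s - G c\<bar> \<le> \<epsilon> * (s - c)"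
              using UB[of s] s True by (auto simp: abs_minus_commute)
          qed (use s in auto)
          then show False using ext u by blast
        next
          case False
          define u where "u = fwd_jump T c"
          have cu: "c < u" using False fwd_jump_ge[of c T] by (simp add: u_def)
          have uT: "u \<in> T" "u \<le> b"
            using fwd_jump_in[OF T cT] fwd_jump_le[of b T c] ab \<open>c < b\<close> by (auto simp: u_def)
          have "P u"
            using UB[of c] U cT cu by (intro step') (auto simp: u_def)
          moreover have "s = u" if "s \<in> T" "c < s" "s \<le> u" for s
            using fwd_jump_le[of s T c] that by (auto simp: u_def)
          ultimately show False using ext[OF uT(1) cu uT(2)] by blast
        qed
      qed
    qed
    then show ?thesis using Pc by (simp add: P_def)
  qed
  have "\<bar>G b - G a\<bar> \<le> 0 + \<eta>" if \<eta>: "\<eta> > 0" for \<eta>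
  proof -
    define M where "M = (b - a) + \<phi> b"
    have "M \<ge> 0" using ab \<phi>0[of b] by (simp add: M_def)
    have "\<bar>G b - G a\<bar> \<le> \<eta> / (M + 1) * M"
      unfolding M_def by (rule main) (use \<eta> \<open>M \<ge> 0\<close> in \<open>auto simp: M_def\<close>)
    also have "\<dots> \<le> \<eta>" using \<eta> \<open>M \<ge> 0\<close> by (simp add: field_simps)
    finally show ?thesis by simp
  qed
  then have "\<bar>G b - G a\<bar> \<le> 0" by (rule field_le_epsilon)
  then show ?thesis by simp
qed

lemma has_delta_derivative_diff:
  assumes "has_delta_derivative T F D t" "has_delta_derivative T G E t"
  shows "has_delta_derivative T (\<lambda>x. F x - G x) (D - E) t"
  unfolding has_delta_derivative_def
proof (intro allI impI)
  fix \<epsilon> :: real assume "\<epsilon> > 0"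
  then have h: "\<epsilon> / 2 > 0" by simp
  let ?r = "fwd_jump T t"
  obtain U where U: "open U" "t \<in> U"
    "\<And>s. s \<in> U \<inter> T \<Longrightarrow> \<bar>F ?r - F s - D * (?r - s)\<bar> \<le> \<epsilon> / 2 * \<bar>?r - s\<bar>"
    by (rule has_delta_derivativeE[OF assms(1) h]) (rule that)
  obtain V where V: "open V" "t \<in> V"
    "\<And>s. s \<in> V \<inter> T \<Longrightarrow> \<bar>G ?r - G s - E * (?r - s)\<bar> \<le> \<epsilon> / 2 * \<bar>?r - s\<bar>"
    by (rule has_delta_derivativeE[OF assms(2) h]) (rule that)
  have "\<bar>F ?r - G ?r - (F s - G s) - (D - E) * (?r - s)\<bar> \<le> \<epsilon> * \<bar>?r - s\<bar>"
    if "s \<in> (U \<inter> V) \<inter> T" for s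
  proof -
    have "F ?r - G ?r - (F s - G s) - (D - E) * (?r - s)
        = (F ?r - F s - D * (?r - s)) - (G ?r - G s - E * (?r - s))"
      by (simp add: algebra_simps)
    moreover have "\<bar>F ?r - F s - D * (?r - s)\<bar> \<le> \<epsilon> / 2 * \<bar>?r - s\<bar>"
      using U(3) that by blast
    moreover have "\<bar>G ?r - G s - E * (?r - s)\<bar> \<le> \<epsilon> / 2 * \<bar>?r - s\<bar>"
      using V(3) that by blast
    ultimately show ?thesis by linarith
  qed
  then show "\<exists>W. open W \<and> t \<in> W \<and> (\<forall>s\<in>W \<inter> T.
      \<bar>F ?r - G ?r - (F s - G s) - (D - E) * (?r - s)\<bar> \<le> \<epsilon> * \<bar>?r - s\<bar>)"
    using U V by (intro exI[of _ "U \<inter> V"]) auto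
qed

lemma delta_pre_antiderivative_unique:
  assumes T: "closed T" and ab: "a \<in> T" "b \<in> T"
    and F: "delta_pre_antiderivative T f F" and G: "delta_pre_antiderivative T f G"
  shows "F b - F a = G b - G a"
proof -
  obtain M where M: "countable M" "\<forall>t\<in>M. fwd_jump T t = t"
    "\<forall>t\<in>ts_kappa T - M. has_delta_derivative T F (f t) t" "continuous_on T F"
    using F unfolding delta_pre_antiderivative_def by blast
  obtain N where N: "countable N" "\<forall>t\<in>N. fwd_jump T t = t"
    "\<forall>t\<in>ts_kappa T - N. has_delta_derivative T G (f t) t" "continuous_on T G"
    using G unfolding delta_pre_antiderivative_def by blast
  have "has_delta_derivative T (\<lambda>x. F x - G x) 0 t" if "t \<in> ts_kappa T - (M \<union> N)" for t
    using has_delta_derivative_diff[of T F "f t" t G "f t"] M(3) N(3) that by auto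
  then have "F v - G v = F u - G u" if "u \<in> T" "v \<in> T" "u \<le> v" for u v
    using M N that
    by (intro delta_derivative_zero_imp_const[OF T, of u v "\<lambda>x. F x - G x" "M \<union> N"])
       (auto intro!: continuous_intros)
  from this[of a b] this[of b a] show ?thesis using ab by (cases "a \<le> b") auto
qed

lemma delta_integral_pre_antiderivative:
  assumes "closed T" "a \<in> T" "b \<in> T" "delta_pre_antiderivative T f F"
  shows "delta_integral T a b f = F b - F a"
  unfolding delta_integral_def
proof (rule the_equality)
  show "\<exists>F'. delta_pre_antiderivative T f F' \<and> F b - F a = F' b - F' a"
    using assms(4) by blast
  show "I = F b - F a" if "\<exists>F. delta_pre_antiderivative T f F \<and> I = F b - F a" for I
    using that delta_pre_antiderivative_unique[OF assms(1-3) _ assms(4)] by auto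
qed

lemma delta_integral_antiderivative:
  assumes "closed T" "a \<in> T" "b \<in> T" "delta_antiderivative T f F"
  shows "delta_integral T a b f = F b - F a"
  using assms delta_integral_pre_antiderivative delta_antiderivative_imp_pre by blast

end

theory Submission
  imports Defs
begin

text \<open>The product rule applied to \<open>(w - c) f\<close> on both sides of \<open>x\<close> gives the Montgomery identity,
  which expresses the mean of \<open>K(\<cdot>, x) f\<^sup>\<Delta>\<close> through \<open>f a\<close>, \<open>f b\<close>, \<open>f x\<close> and the integral of
  \<open>\<nu> (f \<circ> \<sigma>)\<close>.  Hence the left-hand side of the theorem is the covariance of \<open>K(\<cdot>, x)\<close> and
  \<open>f\<^sup>\<Delta>\<close>, and the inequality is the Cauchy-Schwarz inequality for it.  The latter follows from the
  positivity of the integral alone: the integral of \<open>(p K + q f\<^sup>\<Delta> + r)\<^sup>2\<close> is nonnegative for all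
  \<open>p\<close>, \<open>q\<close>, \<open>r\<close>.\<close>

section \<open>Calculus of delta derivatives\<close>

text \<open>The filter keeps the point \<open>s = t\<close>, unlike \<open>at t within T\<close>: at
  a right-scattered \<open>t\<close> this single instance, taken for all \<epsilon>, already
  determines the derivative.\<close>

lemma has_delta_derivative_iff_eventually:
  "has_delta_derivative T f D t \<longleftrightarrow>
    (\<forall>\<epsilon>>0. \<forall>\<^sub>F s in inf (nhds t) (principal T).
      \<bar>f (fwd_jump T t) - f s - D * (fwd_jump T t - s)\<bar> \<le> \<epsilon> * \<bar>fwd_jump T t - s\<bar>)"
  unfolding has_delta_derivative_def eventually_inf_principal eventually_nhds
  by (simp only: Ball_def Int_iff imp_conjL)

lemma has_delta_derivative_const: "has_delta_derivative T (\<lambda>_. c) 0 t"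
  by (simp add: has_delta_derivative_iff_eventually)

lemma has_delta_derivative_id: "has_delta_derivative T (\<lambda>s. s) 1 t"
  by (simp add: has_delta_derivative_iff_eventually)

text \<open>The error of the product splits into the error of \<open>f\<close> weighted by
  \<open>g\<close> at the jump, the error of \<open>g\<close> weighted by \<open>f s\<close>, and a
  term with the factor \<open>f s - f t\<close>, which is small because delta differentiability
  implies continuity.\<close>

lemma has_delta_derivative_mult:
  assumes f: "has_delta_derivative T f D t" and g: "has_delta_derivative T g E t" and t: "t \<in> T"
  shows "has_delta_derivative T (\<lambda>s. f s * g s) (f t * E + D * g (fwd_jump T t)) t"
  unfolding has_delta_derivative_iff_eventually
proof (intro allI impI)
  fix \<epsilon> :: real assume \<epsilon>: "\<epsilon> > 0"
  let ?r = "fwd_jump T t"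
  \<comment> \<open>\<open>M\<close> adds up the coefficients of the three error terms; the summand
    \<open>\<bar>f t\<bar> + 1\<close> bounds \<open>\<bar>f s\<bar>\<close> near \<open>t\<close>
    because \<eta> is at most 1.\<close>
  define M where "M = \<bar>g ?r\<bar> + (\<bar>f t\<bar> + 1) + \<bar>E\<bar>"
  have M: "M > 0" by (simp add: M_def)
  define \<eta> where "\<eta> = min 1 (\<epsilon> / M)"
  have \<eta>: "\<eta> > 0" "\<eta> \<le> 1" "\<eta> * M \<le> \<epsilon>"
    using \<epsilon> M by (auto simp: \<eta>_def min_def field_simps)
  have "continuous (at t within T) f"
    using f t by (rule has_delta_derivative_continuous)
  then have "\<forall>\<^sub>F s in at t within T. \<bar>f s - f t\<bar> < \<eta>"
    using \<eta>(1) by (auto simp: continuous_within tendsto_iff dist_real_def)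
  \<comment> \<open>The point \<open>s = t\<close>, absent from the punctured filter, is harmless:
    there the bound reads \<open>0 < \<eta>\<close>.\<close>
  then have "\<forall>\<^sub>F s in inf (nhds t) (principal T). \<bar>f s - f t\<bar> < \<eta>"
    using \<eta>(1) unfolding eventually_at_filter eventually_inf_principal
    by (auto elim!: eventually_mono)
  moreover have "\<forall>\<^sub>F s in inf (nhds t) (principal T). \<bar>f ?r - f s - D * (?r - s)\<bar> \<le> \<eta> * \<bar>?r - s\<bar>"
    using f \<eta>(1) by (simp add: has_delta_derivative_iff_eventually)
  moreover have "\<forall>\<^sub>F s in inf (nhds t) (principal T). \<bar>g ?r - g s - E * (?r - s)\<bar> \<le> \<eta> * \<bar>?r - s\<bar>"
    using g \<eta>(1) by (simp add: has_delta_derivative_iff_eventually)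
  ultimately show "\<forall>\<^sub>F s in inf (nhds t) (principal T).
      \<bar>f ?r * g ?r - f s * g s - (f t * E + D * g ?r) * (?r - s)\<bar> \<le> \<epsilon> * \<bar>?r - s\<bar>"
  proof eventually_elim
    case (elim s)
    let ?d = "\<bar>?r - s\<bar>"
    have "f ?r * g ?r - f s * g s - (f t * E + D * g ?r) * (?r - s)
        = g ?r * (f ?r - f s - D * (?r - s)) + f s * (g ?r - g s - E * (?r - s))
          + (f s - f t) * (E * (?r - s))"
      by (simp add: algebra_simps)
    also have "\<bar>\<dots>\<bar> \<le> \<bar>g ?r\<bar> * \<bar>f ?r - f s - D * (?r - s)\<bar> + \<bar>f s\<bar> * \<bar>g ?r - g s - E * (?r - s)\<bar>
          + \<bar>f s - f t\<bar> * \<bar>E * (?r - s)\<bar>"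
      unfolding abs_mult[symmetric] by linarith
    also have "\<dots> \<le> \<bar>g ?r\<bar> * (\<eta> * ?d) + (\<bar>f t\<bar> + 1) * (\<eta> * ?d) + \<eta> * \<bar>E * (?r - s)\<bar>"
      using elim \<eta> by (intro add_mono mult_mono) auto
    also have "\<dots> = (\<eta> * M) * ?d"
      unfolding abs_mult by (simp add: M_def algebra_simps)
    also have "\<dots> \<le> \<epsilon> * ?d"
      using \<eta>(3) by (intro mult_right_mono) auto
    finally show ?case .
  qed
qed

lemma has_delta_derivative_cmult:
  assumes "has_delta_derivative T f D t" "t \<in> T"
  shows "has_delta_derivative T (\<lambda>s. c * f s) (c * D) t"
  using has_delta_derivative_mult[OF has_delta_derivative_const[of T c t] assms] by simp

lemma has_delta_derivative_add:
  assumes "has_delta_derivative T f D t" "has_delta_derivative T g E t" "t \<in> T"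
  shows "has_delta_derivative T (\<lambda>s. f s + g s) (D + E) t"
  using has_delta_derivative_diff[OF assms(1) has_delta_derivative_cmult[OF assms(2,3), of "-1"]]
  by simp

text \<open>Agreement at the jump is required separately, since small neighborhoods of a
  right-scattered \<open>t\<close> miss \<open>fwd_jump T t\<close>.\<close>

lemma has_delta_derivative_cong_eventually:
  assumes "\<forall>\<^sub>F s in inf (nhds t) (principal T). f s = g s"
    and "f (fwd_jump T t) = g (fwd_jump T t)"
  shows "has_delta_derivative T f D t \<longleftrightarrow> has_delta_derivative T g D t"
  unfolding has_delta_derivative_iff_eventually
  by (intro all_cong eventually_cong[OF assms(1)]) (use assms(2) in auto)

text \<open>At \<open>s = t\<close> the error vanishes while the permitted error is positive, as
  \<open>t\<close> lies strictly before its jump; by continuity the inequality persists near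
  \<open>t\<close>.\<close>

lemma has_delta_derivative_right_scatteredI:
  assumes cont: "continuous (at t within T) F" and t: "t < fwd_jump T t"
    and eq: "F (fwd_jump T t) - F t = D * (fwd_jump T t - t)"
  shows "has_delta_derivative T F D t"
  unfolding has_delta_derivative_iff_eventually
proof (intro allI impI)
  fix \<epsilon> :: real assume \<epsilon>: "\<epsilon> > 0"
  let ?r = "fwd_jump T t"
  have "((\<lambda>s. \<epsilon> * \<bar>?r - s\<bar> - \<bar>F ?r - F s - D * (?r - s)\<bar>) \<longlongrightarrow>
      \<epsilon> * \<bar>?r - t\<bar> - \<bar>F ?r - F t - D * (?r - t)\<bar>) (at t within T)"
    using cont unfolding continuous_within by (intro tendsto_intros)
  moreover have pos: "0 < \<epsilon> * \<bar>?r - t\<bar> - \<bar>F ?r - F t - D * (?r - t)\<bar>"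
    using eq t \<epsilon> by simp
  ultimately have "\<forall>\<^sub>F s in at t within T. 0 < \<epsilon> * \<bar>?r - s\<bar> - \<bar>F ?r - F s - D * (?r - s)\<bar>"
    by (rule order_tendstoD)
  then show "\<forall>\<^sub>F s in inf (nhds t) (principal T). \<bar>F ?r - F s - D * (?r - s)\<bar> \<le> \<epsilon> * \<bar>?r - s\<bar>"
    using pos unfolding eventually_at_filter eventually_inf_principal
    by (auto elim!: eventually_mono)
qed

section \<open>Approximation of dense points and uniqueness of the derivative\<close>

lemma fwd_jump_right_dense_obtain:
  assumes "fwd_jump T t = t" "b \<in> T" "t < b" "d > 0"
  obtains u where "u \<in> T" "t < u" "u < t + d" "u < b"
proof -
  have "Inf {s\<in>T. t < s} < min (t + d) b"
    using assms by (auto simp: fwd_jump_def split: if_splits)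
  moreover have "{s\<in>T. t < s} \<noteq> {}" "bdd_below {s\<in>T. t < s}"
    using assms by (auto intro!: bdd_belowI[of _ t])
  ultimately obtain u where "u \<in> T" "t < u" "u < min (t + d) b"
    using cInf_less_iff[of "{s\<in>T. t < s}" "min (t + d) b"] by blast
  then show thesis using that[of u] by simp
qed

lemma bwd_jump_left_dense_obtain:
  assumes "bwd_jump T t = t" "a \<in> T" "a < t" "d > 0"
  obtains u where "u \<in> T" "u < t" "t - d < u"
proof -
  have "t - d < Sup {s\<in>T. s < t}"
    using assms by (auto simp: bwd_jump_def split: if_splits)
  moreover have "{s\<in>T. s < t} \<noteq> {}" "bdd_above {s\<in>T. s < t}"
    using assms by (auto intro!: bdd_aboveI[of _ t])
  ultimately show thesis
    using less_cSup_iff[of "{s\<in>T. s < t}" "t - d"] that by blast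
qed

lemma bwd_jump_le: "bwd_jump T t \<le> t"
  unfolding bwd_jump_def by (auto intro!: cSup_least)

text \<open>By subtraction, \<open>D - E\<close> is a derivative of the zero function, so it
  suffices to find points \<open>s\<close> arbitrarily near \<open>t\<close> and different from its
  jump, and to divide by the distance. Two distinct points of \<open>T\<close> are required because
  on a singleton every number is a derivative.\<close>

lemma has_delta_derivative_unique:
  assumes D: "has_delta_derivative T f D t" and E: "has_delta_derivative T f E t"
    and t: "t \<in> ts_kappa T" and ab: "a \<in> T" "b \<in> T" "a < b"
  shows "D = E"
proof -
  have tT: "t \<in> T" using t by (simp add: ts_kappa_def)
  have *: "\<exists>s\<in>T. s \<noteq> fwd_jump T t \<and> \<bar>s - t\<bar> < d" if d: "d > 0" for d
  proof (cases "fwd_jump T t = t")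
    case False
    then show ?thesis using tT d by (intro bexI[of _ t]) auto
  next
    case True
    show ?thesis
    proof (cases "\<exists>u\<in>T. t < u")
      case True
      then obtain u where "u \<in> T" "t < u" "u < t + d"
        using fwd_jump_right_dense_obtain[OF \<open>fwd_jump T t = t\<close> _ _ d] by blast
      then show ?thesis using \<open>fwd_jump T t = t\<close> by (intro bexI[of _ u]) auto
    next
      case False
      \<comment> \<open>Here \<open>t\<close> is the maximum of \<open>T\<close>; membership in
        \<open>ts_kappa T\<close> then makes it left-dense, so it is approached from the
        left.\<close>
      then have "bwd_jump T t = t" "a < t"
        using t ab bwd_jump_le[of T t] by (force simp: ts_kappa_def)+
      then obtain u where "u \<in> T" "u < t" "t - d < u"
        using bwd_jump_left_dense_obtain[OF _ ab(1) _ d] by blast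
      then show ?thesis using \<open>fwd_jump T t = t\<close> by (intro bexI[of _ u]) auto
    qed
  qed
  have zero: "has_delta_derivative T (\<lambda>_. 0) (D - E) t"
    using has_delta_derivative_diff[OF D E] by simp
  have "\<bar>D - E\<bar> \<le> 0 + \<epsilon>" if \<epsilon>: "\<epsilon> > 0" for \<epsilon>
  proof -
    obtain U where U: "open U" "t \<in> U" and
      UB: "\<And>s. s \<in> U \<inter> T \<Longrightarrow> \<bar>0 - 0 - (D - E) * (fwd_jump T t - s)\<bar> \<le> \<epsilon> * \<bar>fwd_jump T t - s\<bar>"
      using has_delta_derivativeE[OF zero \<epsilon>] by blast
    obtain d where d: "d > 0" "ball t d \<subseteq> U"
      using openE[OF U] by blast
    obtain s where s: "s \<in> T" "s \<noteq> fwd_jump T t" "\<bar>s - t\<bar> < d"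
      using *[OF d(1)] by blast
    then have "s \<in> U \<inter> T" using d(2) by (auto simp: subset_iff dist_real_def abs_minus_commute)
    from UB[OF this] have "\<bar>D - E\<bar> * \<bar>fwd_jump T t - s\<bar> \<le> \<epsilon> * \<bar>fwd_jump T t - s\<bar>"
      by (simp add: abs_mult)
    then show ?thesis using s(2) by (simp add: mult_le_cancel_right)
  qed
  then have "\<bar>D - E\<bar> \<le> 0" by (rule field_le_epsilon)
  then show ?thesis by simp
qed

lemma delta_differentiable_antiderivative:
  assumes "delta_differentiable T f" and ab: "a \<in> T" "b \<in> T" "a < b"
  shows "delta_antiderivative T (delta_deriv T f) f"
  unfolding delta_antiderivative_def
proof
  fix t assume t: "t \<in> ts_kappa T"
  then obtain D where D: "has_delta_derivative T f D t"
    using assms(1) by (auto simp: delta_differentiable_def)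
  then have "delta_deriv T f t = D"
    unfolding delta_deriv_def
    by (intro the_equality) (auto intro: has_delta_derivative_unique[OF _ _ t ab])
  then show "has_delta_derivative T f (delta_deriv T f t) t" using D by simp
qed

section \<open>Linearity, gluing and positivity for pre-antiderivatives\<close>

lemma delta_pre_antiderivative_add:
  assumes "delta_pre_antiderivative T f F" "delta_pre_antiderivative T g G"
  shows "delta_pre_antiderivative T (\<lambda>t. f t + g t) (\<lambda>t. F t + G t)"
proof -
  obtain M where M: "countable M" "\<forall>t\<in>M. fwd_jump T t = t"
    "\<forall>t\<in>ts_kappa T - M. has_delta_derivative T F (f t) t" "continuous_on T F"
    using assms(1) unfolding delta_pre_antiderivative_def by blast
  obtain N where N: "countable N" "\<forall>t\<in>N. fwd_jump T t = t"
    "\<forall>t\<in>ts_kappa T - N. has_delta_derivative T G (g t) t" "continuous_on T G"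
    using assms(2) unfolding delta_pre_antiderivative_def by blast
  show ?thesis unfolding delta_pre_antiderivative_def
    using M N by (intro conjI exI[of _ "M \<union> N"])
      (auto intro!: continuous_intros has_delta_derivative_add simp: ts_kappa_def)
qed

lemma delta_pre_antiderivative_cmult:
  assumes "delta_pre_antiderivative T f F"
  shows "delta_pre_antiderivative T (\<lambda>t. c * f t) (\<lambda>t. c * F t)"
proof -
  obtain M where M: "countable M" "\<forall>t\<in>M. fwd_jump T t = t"
    "\<forall>t\<in>ts_kappa T - M. has_delta_derivative T F (f t) t" "continuous_on T F"
    using assms(1) unfolding delta_pre_antiderivative_def by blast
  show ?thesis unfolding delta_pre_antiderivative_def
    using M by (intro conjI exI[of _ "M"])
      (auto intro!: continuous_intros has_delta_derivative_cmult simp: ts_kappa_def)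
qed

lemma delta_pre_antiderivative_const: "delta_pre_antiderivative T (\<lambda>_. c) (\<lambda>t. c * t)"
  using has_delta_derivative_cmult[OF has_delta_derivative_id]
  by (intro delta_antiderivative_imp_pre) (auto simp: delta_antiderivative_def ts_kappa_def)

text \<open>This makes the piecewise defined kernel integrable: shifting \<open>G\<close> to meet
  \<open>F\<close> at \<open>x\<close> keeps the glued function continuous. A right-dense
  \<open>x\<close> joins the exceptional set. A right-scattered \<open>x\<close> may not, but there
  the derivative is the difference quotient up to the jump, which involves only increments of
  \<open>G\<close>, in accordance with the value \<open>g x\<close>.\<close>

lemma delta_pre_antiderivative_glue:
  assumes T: "closed T" and x: "x \<in> T"
    and F: "delta_pre_antiderivative T f F" and G: "delta_pre_antiderivative T g G"
  shows "delta_pre_antiderivative T (\<lambda>s. if s < x then f s else g s)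
    (\<lambda>s. if s \<le> x then F s else G s + (F x - G x))" (is "delta_pre_antiderivative T ?h ?H")
proof -
  obtain M where M: "countable M" "\<forall>t\<in>M. fwd_jump T t = t"
    "\<forall>t\<in>ts_kappa T - M. has_delta_derivative T F (f t) t" "continuous_on T F"
    using F unfolding delta_pre_antiderivative_def by blast
  obtain N where N: "countable N" "\<forall>t\<in>N. fwd_jump T t = t"
    "\<forall>t\<in>ts_kappa T - N. has_delta_derivative T G (g t) t" "continuous_on T G"
    using G unfolding delta_pre_antiderivative_def by blast
  have cont: "continuous_on T ?H"
    using M(4) N(4) by (intro continuous_on_cases_le continuous_intros) (auto intro: continuous_on_subset)
  define Z where "Z = M \<union> N \<union> (if fwd_jump T x = x then {x} else {})"
  have "has_delta_derivative T ?H (?h t) t" if t: "t \<in> ts_kappa T - Z" for t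
  proof -
    have tT: "t \<in> T" using t by (simp add: ts_kappa_def)
    have FG: "has_delta_derivative T F (f t) t" "has_delta_derivative T G (g t) t"
      using t M(3) N(3) by (auto simp: Z_def)
    have G': "has_delta_derivative T (\<lambda>s. G s + (F x - G x)) (g t) t"
      using has_delta_derivative_add[OF FG(2) has_delta_derivative_const tT] by simp
    consider "t < x" | "t > x" | "t = x" by linarith
    then show ?thesis
    proof cases
      case 1
      have "\<forall>\<^sub>F s in inf (nhds t) (principal T). s < x"
        using 1 unfolding eventually_inf_principal eventually_nhds by (intro exI[of _ "{..<x}"]) auto
      then have "\<forall>\<^sub>F s in inf (nhds t) (principal T). ?H s = F s"
        by (rule eventually_mono) simp
      \<comment> \<open>The jump of a point before \<open>x\<close> is at most \<open>x\<close>, so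
        it stays in the range where \<open>?H\<close> is \<open>F\<close>.\<close>
      then have "has_delta_derivative T ?H (f t) t"
        using FG(1) fwd_jump_le[OF x 1] has_delta_derivative_cong_eventually[where f = ?H and g = F and t = t and T = T] by simp
      then show ?thesis using 1 by simp
    next
      case 2
      have "\<forall>\<^sub>F s in inf (nhds t) (principal T). x < s"
        using 2 unfolding eventually_inf_principal eventually_nhds by (intro exI[of _ "{x<..}"]) auto
      then have "\<forall>\<^sub>F s in inf (nhds t) (principal T). ?H s = G s + (F x - G x)"
        by (rule eventually_mono) simp
      then have "has_delta_derivative T ?H (g t) t"
        using G' 2 fwd_jump_ge[of t T]
          has_delta_derivative_cong_eventually[where f = ?H and g = "\<lambda>s. G s + (F x - G x)" and t = t and T = T] by simp
      then show ?thesis using 2 by simp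
    next
      case 3
      have scat: "x < fwd_jump T x"
        using t 3 fwd_jump_ge[of x T] by (cases "fwd_jump T x = x") (auto simp: Z_def)
      have "G (fwd_jump T x) - G x - g x * (fwd_jump T x - x) = 0"
      proof -
        \<comment> \<open>The defining estimate is used at \<open>s = x\<close> itself; letting
          \<open>e\<close> tend to 0 turns it into an equation.\<close>
        have "\<bar>G (fwd_jump T x) - G x - g x * (fwd_jump T x - x)\<bar> \<le> 0 + e * (fwd_jump T x - x)"
          if e: "e > 0" for e
          using has_delta_derivativeE[OF FG(2) e] 3 tT scat by (metis IntI abs_of_pos add_0 diff_gt_0_iff_gt)
        then have "\<bar>G (fwd_jump T x) - G x - g x * (fwd_jump T x - x)\<bar> \<le> 0 + e" if e: "e > 0" for e
          using that[THEN divide_pos_pos, of "fwd_jump T x - x"] scat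
          by (smt (verit) nonzero_eq_divide_eq)
        then have "\<bar>G (fwd_jump T x) - G x - g x * (fwd_jump T x - x)\<bar> \<le> 0" by (rule field_le_epsilon)
        then show ?thesis by simp
      qed
      then show ?thesis
        using 3 scat cont x
        by (intro has_delta_derivative_right_scatteredI) (auto simp: continuous_on_eq_continuous_within)
    qed
  qed
  then show ?thesis
    unfolding delta_pre_antiderivative_def using M N cont
    by (intro conjI exI[of _ Z]) (auto simp: Z_def)
qed

text \<open>The countable exceptional set is dealt with by Zygmund's trick: if \<open>H t = F t + \<epsilon> t\<close> decreased
  from \<open>a\<close> to \<open>b\<close>, there would be an intermediate level \<open>y\<close> that \<open>H\<close> takes at no exceptional point,
  and \<open>H\<close> could not drop below \<open>y\<close> after the last time it is at least \<open>y\<close>.\<close>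

lemma delta_pre_antiderivative_nonneg_mono:
  assumes T: "closed T" and ab: "a \<in> T" "b \<in> T" "a \<le> b"
    and F: "delta_pre_antiderivative T f F" and nn: "\<And>t. t \<in> T \<Longrightarrow> f t \<ge> 0"
  shows "F a \<le> F b"
proof (rule ccontr)
  assume less: "\<not> F a \<le> F b"
  then have ab': "a < b" using ab(3) by (cases "a = b") auto
  obtain N where N: "countable N" "\<forall>t\<in>N. fwd_jump T t = t"
    "\<forall>t\<in>ts_kappa T - N. has_delta_derivative T F (f t) t" "continuous_on T F"
    using F unfolding delta_pre_antiderivative_def by blast
  \<comment> \<open>With half the average descent as slope, the added linear term makes up for only
    half of the drop of \<open>F\<close>, so \<open>H\<close> still decreases from \<open>a\<close>
    to \<open>b\<close>.\<close>
  define \<epsilon> where "\<epsilon> = (F a - F b) / 2 / (b - a)"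
  have \<epsilon>: "\<epsilon> > 0" using less ab' by (simp add: \<epsilon>_def)
  define H where "H t = F t + \<epsilon> * t" for t
  have "\<epsilon> * (b - a) = (F a - F b) / 2"
    unfolding \<epsilon>_def using ab' by (intro nonzero_eq_divide_eq[THEN iffD1] refl) simp
  then have "H b < H a" using less unfolding H_def by (simp add: algebra_simps)
  then have "uncountable {H b<..<H a}" by (simp add: uncountable_open_interval)
  then have "\<not> {H b<..<H a} \<subseteq> H ` N"
    using countable_subset[OF _ countable_image[OF N(1)]] by auto
  then obtain y where y: "H b < y" "y < H a" "y \<notin> H ` N"
    unfolding subset_iff greaterThanLessThan_iff by blast
  have Hder: "has_delta_derivative T H (f t + \<epsilon>) t" if "t \<in> ts_kappa T - N" for t
    unfolding H_def
    using has_delta_derivative_add[OF N(3)[rule_format, OF that]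
        has_delta_derivative_cmult[OF has_delta_derivative_id]] that
    by (auto simp: ts_kappa_def)
  have Hcont: "continuous_on T H"
    unfolding H_def using N(4) by (intro continuous_intros)
  define A where "A = {t \<in> T \<inter> {a..b}. y \<le> H t}"
  have "closed (T \<inter> {a..b})" using T by (intro closed_Int) auto
  then have A: "closed A"
    unfolding A_def using Hcont
    by (intro continuous_on_closed_Collect_le[OF _ _ \<open>closed (T \<inter> {a..b})\<close>] continuous_intros)
      (auto intro: continuous_on_subset)
  define c where "c = Sup A"
  have "a \<in> A" "bdd_above A"
    using ab y by (auto simp: A_def intro: bdd_aboveI[of _ b])
  then have cA: "c \<in> A" and c_up: "\<And>t. t \<in> A \<Longrightarrow> t \<le> c"
    using A unfolding c_def by (auto intro: closed_contains_Sup cSup_upper)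
  then have c: "c \<in> T" "a \<le> c" "c < b" "y \<le> H c"
    using y(1) by (auto simp: A_def order.order_iff_strict)
  have above: "H t < y" if "t \<in> T" "c < t" "t \<le> b" for t
    using c_up[of t] that c by (force simp: A_def)
  have ck: "c \<in> ts_kappa T" using c ab by (force simp: ts_kappa_def)
  show False
  proof (cases "fwd_jump T c = c")
    case True
    \<comment> \<open>Points of \<open>T\<close> accumulate at \<open>c\<close> from the right and
      \<open>H\<close> is below \<open>y\<close> there, so by continuity \<open>H c = y\<close>. As
      \<open>y\<close> is no exceptional value, \<open>c\<close> is not in \<open>N\<close>.\<close>
    have "H c \<le> y"
    proof (rule ccontr)
      assume "\<not> H c \<le> y"
      then obtain d where d: "d > 0" "\<And>t. t \<in> T \<Longrightarrow> \<bar>t - c\<bar> < d \<Longrightarrow> \<bar>H t - H c\<bar> < H c - y"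
        using Hcont[unfolded continuous_on_iff dist_real_def, rule_format, OF c(1), of "H c - y"]
        by auto
      obtain u where u: "u \<in> T" "c < u" "u < c + d" "u < b"
        using fwd_jump_right_dense_obtain[OF True ab(2) c(3) d(1)] by blast
      then show False using d(2)[of u] above[of u] by auto
    qed
    then have "c \<notin> N" using c(4) y(3) by force
    then have Hc: "has_delta_derivative T H (f c + \<epsilon>) c" using Hder ck by blast
    obtain U where U: "open U" "c \<in> U"
      "\<And>s. s \<in> U \<inter> T \<Longrightarrow> \<bar>H c - H s - (f c + \<epsilon>) * (c - s)\<bar> \<le> \<epsilon> / 2 * \<bar>c - s\<bar>"
      using has_delta_derivativeE[OF Hc, of "\<epsilon> / 2"] \<epsilon> True by auto
    obtain d where d: "d > 0" "ball c d \<subseteq> U"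
      using openE[OF U(1,2)] by blast
    obtain u where u: "u \<in> T" "c < u" "u < c + d" "u < b"
      using fwd_jump_right_dense_obtain[OF True ab(2) c(3) d(1)] by blast
    then have "u \<in> U" using d(2) by (auto simp: subset_iff dist_real_def)
    then have 1: "\<bar>H c - H u - (f c + \<epsilon>) * (c - u)\<bar> \<le> \<epsilon> / 2 * (u - c)"
      using U(3)[of u] u by simp
    have "(f c + \<epsilon>) * (u - c) \<ge> \<epsilon> * (u - c)"
      using nn[OF c(1)] u by (intro mult_right_mono) auto
    moreover have "\<epsilon> * (u - c) > 0" using \<epsilon> u by simp
    moreover have "(f c + \<epsilon>) * (c - u) = - ((f c + \<epsilon>) * (u - c))"
      by (simp add: algebra_simps)
    moreover have "\<epsilon> / 2 * (u - c) = \<epsilon> * (u - c) / 2" by simp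
    \<comment> \<open>The slope at \<open>c\<close> is at least \<epsilon> and the error at most
      half of that, so \<open>H\<close> rises to the right of \<open>c\<close>.\<close>
    ultimately have "H c < H u" using 1 by linarith
    then show False using above[of u] u c(4) by auto
  next
    case False
    define u where "u = fwd_jump T c"
    have cu: "c < u" using False fwd_jump_ge[of c T] by (simp add: u_def)
    have uT: "u \<in> T" "u \<le> b"
      using fwd_jump_in[OF T c(1)] fwd_jump_le[OF ab(2) c(3)] by (auto simp: u_def)
    have "c \<notin> N" using N(2) False by blast
    then have Hc: "has_delta_derivative T H (f c + \<epsilon>) c" using Hder ck by blast
    have "\<bar>H u - H c - (f c + \<epsilon>) * (u - c)\<bar> \<le> \<epsilon> * (u - c)"
      using has_delta_derivativeE[OF Hc \<epsilon>] c(1) cu unfolding u_def[symmetric]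
      by (metis IntI abs_of_pos diff_gt_0_iff_gt)
    moreover have "(f c + \<epsilon>) * (u - c) \<ge> \<epsilon> * (u - c)"
      using nn[OF c(1)] cu by (intro mult_right_mono) auto
    ultimately have "H c \<le> H u" by linarith
    then show False using above[OF uT(1) cu uT(2)] c(4) by simp
  qed
qed

section \<open>Properties of rd-continuous functions\<close>

lemma rd_continuous_mult:
  assumes "rd_continuous T f" "rd_continuous T g"
  shows "rd_continuous T (\<lambda>t. f t * g t)"
  using assms unfolding rd_continuous_def
  by (metis (no_types) continuous_mult tendsto_mult)

lemma continuous_on_imp_rd_continuous:
  assumes "continuous_on T f"
  shows "rd_continuous T f"
  using assms unfolding rd_continuous_def continuous_on_eq_continuous_within continuous_within
  by (meson Int_lower1 tendsto_within_subset)

text \<open>The jumps of points \<open>s < t\<close> of \<open>T\<close> lie between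
  \<open>s\<close> and \<open>t\<close>, so they tend to \<open>t\<close> from the left at every
  \<open>t\<close>. At a right-dense \<open>t\<close>, points of \<open>T\<close> slightly to the
  right of \<open>t\<close> bound the jumps from above, so the jumps also tend to \<open>t\<close>
  from that side.\<close>

lemma rd_continuous_compose_fwd_jump:
  assumes T: "closed T" and f: "continuous_on T f"
  shows "rd_continuous T (\<lambda>t. f (fwd_jump T t))"
proof -
  have right: "\<exists>d>0. \<forall>s\<in>T. \<bar>s - t\<bar> < d \<longrightarrow> \<bar>fwd_jump T s - t\<bar> < e"
    if t: "t \<in> T" "fwd_jump T t = t" "e > 0" for t e
  proof (cases "\<exists>u\<in>T. t < u")
    case True
    then obtain u where u: "u \<in> T" "t < u" "u < t + e"
      using fwd_jump_right_dense_obtain[OF t(2) _ _ t(3)] by blast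
    have "\<bar>fwd_jump T s - t\<bar> < e" if "s \<in> T" "\<bar>s - t\<bar> < min e (u - t)" for s
    proof -
      have "fwd_jump T s \<le> u" using that by (intro fwd_jump_le[OF u(1)]) linarith
      then show ?thesis using fwd_jump_ge[of s T] that u by linarith
    qed
    then show ?thesis using u t(3) by (intro exI[of _ "min e (u - t)"]) auto
  next
    case False
    have "\<bar>fwd_jump T s - t\<bar> < e" if s: "s \<in> T" "\<bar>s - t\<bar> < e" for s
    proof (cases "s = t")
      case False
      then have "s < t" using \<open>\<not> (\<exists>u\<in>T. t < u)\<close> s by force
      then show ?thesis using fwd_jump_ge[of s T] fwd_jump_le[OF t(1), of s] s by auto
    qed (use t in auto)
    then show ?thesis using t(3) by blast
  qed
  have left: "\<exists>d>0. \<forall>s\<in>T \<inter> {..<t}. \<bar>s - t\<bar> < d \<longrightarrow> \<bar>fwd_jump T s - t\<bar> < e"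
    if t: "t \<in> T" "e > 0" for t e
  proof (intro exI[of _ e] conjI ballI impI t(2))
    fix s assume "s \<in> T \<inter> {..<t}" "\<bar>s - t\<bar> < e"
    then show "\<bar>fwd_jump T s - t\<bar> < e"
      using fwd_jump_ge[of s T] fwd_jump_le[OF t(1), of s] by simp
  qed
  have lim: "((\<lambda>s. f (fwd_jump T s)) \<longlongrightarrow> f t) (at t within S)"
    if "t \<in> T" "S \<subseteq> T" "(fwd_jump T \<longlongrightarrow> t) (at t within S)" for t S
  proof (rule continuous_within_tendsto_compose[OF _ _ that(3)])
    show "continuous (at t within T) f"
      using f that(1) by (simp add: continuous_on_eq_continuous_within)
    show "\<forall>\<^sub>F s in at t within S. fwd_jump T s \<in> T"
      using that(2) fwd_jump_in[OF T] unfolding eventually_at_filter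
      by (intro always_eventually) auto
  qed
  show ?thesis
    unfolding rd_continuous_def
  proof (intro conjI ballI impI)
    fix t assume t: "t \<in> T" "fwd_jump T t = t"
    have "(fwd_jump T \<longlongrightarrow> t) (at t within T)"
      using right[OF t] unfolding Lim_within dist_real_def by blast
    then show "continuous (at t within T) (\<lambda>t. f (fwd_jump T t))"
      using lim[of t T] t unfolding continuous_within by simp
  next
    fix t assume t: "t \<in> T"
    have "(fwd_jump T \<longlongrightarrow> t) (at t within (T \<inter> {..<t}))"
      using left[OF t] unfolding Lim_within dist_real_def by blast
    then show "\<exists>l. ((\<lambda>t. f (fwd_jump T t)) \<longlongrightarrow> l) (at t within T \<inter> {..<t})"
      using lim[of t "T \<inter> {..<t}"] t by blast
  qed
qed

text \<open>Next to each point, on either side, there is a one-sided limit or a gap without points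
  of \<open>T\<close>; either gives a local bound, and compactness makes it global.\<close>

lemma rd_continuous_bounded:
  assumes T: "compact T" and g: "rd_continuous T g"
  obtains B where "\<And>t. t \<in> T \<Longrightarrow> \<bar>g t\<bar> \<le> B"
proof -
  define C where "C = {U. open U \<and> (\<exists>B. \<forall>s\<in>U \<inter> T. \<bar>g s\<bar> \<le> B)}"
  have tend: "\<exists>d>0. \<forall>s\<in>S. \<bar>s - t\<bar> < d \<longrightarrow> s \<noteq> t \<longrightarrow> \<bar>g s\<bar> \<le> \<bar>l\<bar> + 1"
    if "(g \<longlongrightarrow> l) (at t within S)" for l t S
  proof -
    have "\<exists>d>0. \<forall>s\<in>S. 0 < \<bar>s - t\<bar> \<and> \<bar>s - t\<bar> < d \<longrightarrow> \<bar>g s - l\<bar> < 1"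
      using that[unfolded Lim_within dist_real_def] zero_less_one by blast
    then obtain d where d: "d > 0" "\<forall>s\<in>S. 0 < \<bar>s - t\<bar> \<and> \<bar>s - t\<bar> < d \<longrightarrow> \<bar>g s - l\<bar> < 1"
      by blast
    have "\<bar>g s\<bar> \<le> \<bar>l\<bar> + 1" if "s \<in> S" "\<bar>s - t\<bar> < d" "s \<noteq> t" for s
      using d(2)[rule_format, of s] that by linarith
    then show ?thesis using d(1) by blast
  qed
  have loc: "\<exists>U\<in>C. t \<in> U" if t: "t \<in> T" for t
  proof -
    have left: "\<exists>B d. d > 0 \<and> (\<forall>s\<in>T. t - d < s \<longrightarrow> s < t \<longrightarrow> \<bar>g s\<bar> \<le> B)"
    proof (cases "bwd_jump T t = t")
      case True
      then obtain l where "(g \<longlongrightarrow> l) (at t within (T \<inter> {..<t}))"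
        using g t unfolding rd_continuous_def by blast
      then obtain d where "d > 0" "\<forall>s\<in>T \<inter> {..<t}. \<bar>s - t\<bar> < d \<longrightarrow> s \<noteq> t \<longrightarrow> \<bar>g s\<bar> \<le> \<bar>l\<bar> + 1"
        using tend by blast
      then show ?thesis by (intro exI[of _ "\<bar>l\<bar> + 1"] exI[of _ d]) auto
    next
      case False
      then have lt: "bwd_jump T t < t" using bwd_jump_le[of T t] by simp
      have "s \<le> bwd_jump T t" if "s \<in> T" "s < t" for s
        using that unfolding bwd_jump_def by (auto intro!: cSup_upper bdd_aboveI[of _ t])
      \<comment> \<open>The bound 0 holds vacuously inside the gap.\<close>
      then show ?thesis using lt by (intro exI[of _ 0] exI[of _ "t - bwd_jump T t"]) force
    qed
    have right: "\<exists>B d. d > 0 \<and> (\<forall>s\<in>T. t < s \<longrightarrow> s < t + d \<longrightarrow> \<bar>g s\<bar> \<le> B)"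
    proof (cases "fwd_jump T t = t")
      case True
      then have "(g \<longlongrightarrow> g t) (at t within T)"
        using g t unfolding rd_continuous_def continuous_within by blast
      then obtain d where "d > 0" "\<forall>s\<in>T. \<bar>s - t\<bar> < d \<longrightarrow> s \<noteq> t \<longrightarrow> \<bar>g s\<bar> \<le> \<bar>g t\<bar> + 1"
        using tend by blast
      then show ?thesis by (intro exI[of _ "\<bar>g t\<bar> + 1"] exI[of _ d]) auto
    next
      case False
      then have "t < fwd_jump T t" using fwd_jump_ge[of t T] by simp
      then show ?thesis
        using fwd_jump_le[of _ T t] by (intro exI[of _ 0] exI[of _ "fwd_jump T t - t"]) force
    qed
    obtain B1 d1 where 1: "d1 > 0" "\<And>s. s \<in> T \<Longrightarrow> t - d1 < s \<Longrightarrow> s < t \<Longrightarrow> \<bar>g s\<bar> \<le> B1"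
      using left by blast
    obtain B2 d2 where 2: "d2 > 0" "\<And>s. s \<in> T \<Longrightarrow> t < s \<Longrightarrow> s < t + d2 \<Longrightarrow> \<bar>g s\<bar> \<le> B2"
      using right by blast
    have "\<bar>g s\<bar> \<le> max (max B1 B2) \<bar>g t\<bar>" if "s \<in> {t - d1<..<t + d2} \<inter> T" for s
      using 1(2)[of s] 2(2)[of s] that by (cases s t rule: linorder_cases) auto
    then have "{t - d1<..<t + d2} \<in> C"
      unfolding C_def by (intro CollectI conjI open_greaterThanLessThan exI ballI)
    then show ?thesis using 1(1) 2(1) by (intro bexI) auto
  qed
  have "\<forall>U\<in>C. open U" by (simp add: C_def)
  moreover have "T \<subseteq> \<Union>C" using loc by blast
  ultimately obtain D where D: "D \<subseteq> C" "finite D" "T \<subseteq> \<Union>D"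
    by (meson T compactE)
  have "\<forall>U\<in>D. \<exists>B. \<forall>s\<in>U \<inter> T. \<bar>g s\<bar> \<le> B"
    using D(1) by (auto simp: C_def)
  from bchoice[OF this] obtain B where B: "\<forall>U\<in>D. \<forall>s\<in>U \<inter> T. \<bar>g s\<bar> \<le> B U" ..
  have "\<bar>g t\<bar> \<le> (\<Sum>U\<in>D. \<bar>B U\<bar>)" if t: "t \<in> T" for t
  proof -
    obtain U where U: "U \<in> D" "t \<in> U" using D(3) t by blast
    then have "\<bar>g t\<bar> \<le> B U" using B t by blast
    also have "\<dots> \<le> \<bar>B U\<bar>" by simp
    also have "\<dots> \<le> (\<Sum>U\<in>D. \<bar>B U\<bar>)" using D(2) U by (intro member_le_sum) auto
    finally show ?thesis .
  qed
  then show thesis by (rule that)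
qed

section \<open>Antiderivatives of rd-continuous functions\<close>

text \<open>The function is a pointwise limit of step functions that sample it at the next grid
  point to the right; these depend on \<open>u\<close> only through an integer.\<close>

lemma borel_measurable_right_continuous:
  fixes h :: "real \<Rightarrow> real"
  assumes "\<And>u. (h \<longlongrightarrow> h u) (at_right u)"
  shows "h \<in> borel_measurable borel"
proof (rule borel_measurable_LIMSEQ_real)
  \<comment> \<open>Floor plus one, rather than the ceiling, keeps \<open>r n u\<close> strictly
    above \<open>u\<close>, as the filter \<open>at_right u\<close> demands.\<close>
  define r where "r n u = (of_int \<lfloor>real (Suc n) * u\<rfloor> + 1) / real (Suc n)" for n and u :: real
  show "(\<lambda>u. h (r n u)) \<in> borel_measurable borel" for n
  proof -
    have "(\<lambda>k::int. h ((of_int k + 1) / real (Suc n))) \<in> borel_measurable (count_space UNIV)"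
      by simp
    moreover have "(\<lambda>u. \<lfloor>real (Suc n) * u\<rfloor>) \<in> measurable borel (count_space UNIV)"
      by measurable
    ultimately show ?thesis
      unfolding r_def using measurable_compose by blast
  qed
  show "(\<lambda>n. h (r n u)) \<longlonglongrightarrow> h u" for u
  proof -
    have bounds: "u < r n u" "r n u \<le> u + 1 / real (Suc n)" for n
    proof -
      have "real (Suc n) * u < of_int \<lfloor>real (Suc n) * u\<rfloor> + 1"
        "of_int \<lfloor>real (Suc n) * u\<rfloor> \<le> real (Suc n) * u" by linarith+
      then show "u < r n u" "r n u \<le> u + 1 / real (Suc n)"
        unfolding r_def by (simp_all add: field_simps del: of_nat_Suc)
    qed
    have "(\<lambda>n. u + 1 / real (Suc n)) \<longlonglongrightarrow> u + 0"
      using LIMSEQ_inverse_real_of_nat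
      by (intro tendsto_add tendsto_const) (simp only: inverse_eq_divide)
    then have "(\<lambda>n. r n u) \<longlonglongrightarrow> u"
      using bounds by (intro tendsto_sandwich[OF _ _ tendsto_const, of u "\<lambda>n. r n u" sequentially])
        (auto intro: always_eventually less_imp_le)
    then have "filterlim (\<lambda>n. r n u) (at_right u) sequentially"
      using bounds unfolding at_within_def filterlim_inf filterlim_principal
      by (auto simp: less_imp_neq[symmetric])
    then show ?thesis by (rule filterlim_compose[OF assms])
  qed
qed

text \<open>The antiderivative of \<open>g\<close> is the integral of its right-continuous step extension: every
  gap \<open>(t, \<sigma>(t))\<close> of the time scale is filled with the value \<open>g t\<close>.\<close>

lemma rd_continuous_antiderivative:
  assumes J: "closed J" "a \<in> J" "b \<in> J" "J \<subseteq> {a..b}" and g: "rd_continuous J g"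
  obtains G where "delta_antiderivative J g G"
proof -
  \<comment> \<open>\<open>p u\<close> is the last point of \<open>J\<close> up to \<open>u\<close>;
    the maximum with \<open>a\<close> sends everything left of \<open>a\<close> to
    \<open>a\<close>.\<close>
  define p where "p u = Sup (J \<inter> {..max a u})" for u
  define h where "h u = g (p u)" for u
  have ne: "J \<inter> {..max a u} \<noteq> {}" and bdd: "bdd_above (J \<inter> {..max a u})" for u
    using J(2) by auto
  have "p u \<in> J \<inter> {..max a u}" for u
    unfolding p_def using ne bdd J(1) by (intro closed_contains_Sup closed_Int) auto
  then have pJ: "p u \<in> J" and p_le: "p u \<le> max a u" for u by auto
  have p_ge: "s \<le> p u" if "s \<in> J" "s \<le> max a u" for s u
    unfolding p_def using that bdd by (intro cSup_upper) auto
  have p_mono: "p u \<le> p v" if "u \<le> v" for u v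
    using p_ge[OF pJ, of u v] p_le[of u] that by linarith
  have p_id: "p t = t" if "t \<in> J" for t
    using p_ge[OF that, of t] p_le[of t] that J(4) by (auto simp: max_def split: if_splits)
  have gap: "q = t" if "q \<in> J" "t \<le> q" "q < fwd_jump J t" for q t
    using fwd_jump_le[OF that(1), of t] that by linarith
  have "(h \<longlongrightarrow> h u) (at_right u)" for u
  proof -
    let ?t = "p u"
    have later: "\<forall>\<^sub>F v in at_right u. u < v" by (rule eventually_at_right_less)
    \<comment> \<open>To the right of \<open>u\<close>, the function \<open>h\<close> is constant if
      \<open>?t\<close> starts a gap or is the maximum of \<open>J\<close>. Otherwise
      \<open>?t\<close> is right-dense and \<open>p\<close> tends to \<open>?t\<close>, where
      \<open>g\<close> is continuous.\<close>
    consider "?t < fwd_jump J ?t" | "\<not> (\<exists>s\<in>J. ?t < s)"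
      | s where "fwd_jump J ?t = ?t" "s \<in> J" "?t < s"
      using fwd_jump_ge[of ?t J] by force
    then show ?thesis
    proof cases
      case 1
      have "max a u < fwd_jump J ?t"
        using p_ge[OF fwd_jump_in[OF J(1) pJ], of u u] 1 by linarith
      then have "u < fwd_jump J ?t" "a < fwd_jump J ?t" by auto
      then have "\<forall>\<^sub>F v in at_right u. v < fwd_jump J ?t"
        unfolding eventually_at_right_field by blast
      with later have "\<forall>\<^sub>F v in at_right u. h v = h u"
      proof eventually_elim
        case (elim v)
        have "p v < fwd_jump J ?t"
          using p_le[of v] elim \<open>a < fwd_jump J ?t\<close> by linarith
        then have "p v = ?t" using gap[OF pJ p_mono] elim by simp
        then show ?case by (simp add: h_def)
      qed
      then show ?thesis by (rule tendsto_eventually)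
    next
      case 2
      have "h v = h u" if "u < v" for v
        using 2 pJ[of v] p_mono[of u v] that unfolding h_def by force
      with later have "\<forall>\<^sub>F v in at_right u. h v = h u" by (auto elim: eventually_mono)
      then show ?thesis by (rule tendsto_eventually)
    next
      case 3
      have t: "?t = max a u"
      proof (rule ccontr)
        assume "?t \<noteq> max a u"
        then have "max a u - ?t > 0" using p_le[of u] by linarith
        then obtain r where "r \<in> J" "?t < r" "r < ?t + (max a u - ?t)"
          using fwd_jump_right_dense_obtain[OF 3] by blast
        then show False using p_ge[of r u] by simp
      qed
      have "((\<lambda>v. max a v) \<longlongrightarrow> ?t) (at_right u)"
        unfolding t by (intro tendsto_max tendsto_const tendsto_ident_at)
      then have "(p \<longlongrightarrow> ?t) (at_right u)"
        by (rule tendsto_sandwich[OF _ _ tendsto_const, rotated 2])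
           (use later p_mono p_le in \<open>auto elim!: eventually_mono\<close>)
      from continuous_within_tendsto_compose'[OF _ pJ this, of g] show ?thesis
        using g 3(1) pJ unfolding rd_continuous_def h_def by blast
    qed
  qed
  then have meas: "h \<in> borel_measurable borel" by (rule borel_measurable_right_continuous)
  have "compact J"
    using J(1,4) bounded_subset[OF bounded_closed_interval] by (auto simp: compact_eq_bounded_closed)
  then obtain B where B: "\<And>t. t \<in> J \<Longrightarrow> \<bar>g t\<bar> \<le> B"
    using rd_continuous_bounded[OF _ g] by blast
  have hint: "h integrable_on {x..y}" for x y
  proof (rule measurable_bounded_by_integrable_imp_integrable)
    have "h \<in> borel_measurable lebesgue"
      using meas by (intro measurable_completion) simp
    then show "h \<in> borel_measurable (lebesgue_on {x..y})" by (rule measurable_restrict_space1)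
    show "norm (h u) \<le> B" for u using B[OF pJ] by (simp add: h_def)
  qed auto
  define G where "G t = integral {a..t} h" for t
  have Gdiff: "G y - G x = integral {x..y} h" if "a \<le> x" "x \<le> y" for x y
    using Henstock_Kurzweil_Integration.integral_combine[OF that hint] by (simp add: G_def)
  have Gcont: "continuous_on J G"
    unfolding G_def using indefinite_integral_continuous_1[OF hint] J(4) continuous_on_subset by blast
  have est: "\<bar>G y - G x - c * (y - x)\<bar> \<le> e * (y - x)"
    if xy: "a \<le> x" "x \<le> y" and e: "e \<ge> 0" "\<And>u. u \<in> {x..y} \<Longrightarrow> \<bar>h u - c\<bar> \<le> e" for x y c e
  proof -
    have "((\<lambda>u. c) has_integral c * (y - x)) {x..y}"
      using has_integral_const_real[of c x y] xy by (simp add: mult.commute)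
    then have "((\<lambda>u. h u - c) has_integral (integral {x..y} h - c * (y - x))) {x..y}"
      by (intro has_integral_diff integrable_integral hint)
    from has_integral_bound_real[OF e(1) _ this, of "{}"] e(2) show ?thesis
      using xy by (simp add: Gdiff)
  qed
  have "has_delta_derivative J G (g t) t" if t: "t \<in> ts_kappa J" for t
  proof -
    have tJ: "t \<in> J" "a \<le> t" using t J(4) by (auto simp: ts_kappa_def)
    show ?thesis
    proof (cases "fwd_jump J t = t")
      case False
      then have less: "t < fwd_jump J t" using fwd_jump_ge[of t J] by simp
      have "h u = g t" if "u \<in> {t..fwd_jump J t} - {fwd_jump J t}" for u
      proof -
        have "p u = t"
          using gap[of "p u" t] pJ[of u] p_ge[of t u] p_le[of u] that tJ by auto
        then show ?thesis by (simp add: h_def)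
      qed
      \<comment> \<open>Only at the right end of the gap may \<open>h\<close> differ from
        \<open>g t\<close>.\<close>
      then have "integral {t..fwd_jump J t} h = integral {t..fwd_jump J t} (\<lambda>_. g t)"
        by (intro integral_spike[of "{fwd_jump J t}"]) auto
      then have "G (fwd_jump J t) - G t = g t * (fwd_jump J t - t)"
        using Gdiff[OF tJ(2), of "fwd_jump J t"] less by simp
      then show ?thesis
        using Gcont tJ less by (intro has_delta_derivative_right_scatteredI)
          (auto simp: continuous_on_eq_continuous_within)
    next
      case True
      show ?thesis
        unfolding has_delta_derivative_def True
      proof (intro allI impI)
        fix \<epsilon> :: real assume \<epsilon>: "\<epsilon> > 0"
        have "continuous (at t within J) g"
          using g True tJ unfolding rd_continuous_def by blast
        then obtain d where d: "d > 0" "\<And>r. r \<in> J \<Longrightarrow> \<bar>r - t\<bar> < d \<Longrightarrow> \<bar>g r - g t\<bar> < \<epsilon>"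
          using \<epsilon> unfolding continuous_within_eps_delta dist_real_def by metis
        have near: "\<bar>G y - G x - g t * (y - x)\<bar> \<le> \<epsilon> * (y - x)"
          if xy: "x \<in> J" "y \<in> J" "x \<le> y" "\<bar>x - t\<bar> < d" "\<bar>y - t\<bar> < d" for x y
        proof (rule est)
          show "a \<le> x" using xy(1) J(4) by auto
          fix u assume u: "u \<in> {x..y}"
          \<comment> \<open>Since \<open>x\<close> is in \<open>J\<close>, \<open>p\<close> maps the
            interval into itself, so \<open>h\<close> only takes values of \<open>g\<close> near
            \<open>t\<close> there.\<close>
          have "x \<le> p u" "p u \<le> y"
            using p_ge[OF xy(1), of u] p_le[of u] u \<open>a \<le> x\<close> by auto
          then have "\<bar>p u - t\<bar> < d" using xy(4,5) by linarith
          then show "\<bar>h u - g t\<bar> \<le> \<epsilon>" using d(2)[OF pJ] unfolding h_def by (simp add: less_imp_le)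
        qed (use \<epsilon> xy in auto)
        have "\<bar>G t - G s - g t * (t - s)\<bar> \<le> \<epsilon> * \<bar>t - s\<bar>" if s: "s \<in> {t - d<..<t + d} \<inter> J" for s
        proof (cases "s \<le> t")
          case True
          then show ?thesis using near[of s t] s tJ d(1) by auto
        next
          case False
          then have "\<bar>G s - G t - g t * (s - t)\<bar> \<le> \<epsilon> * (s - t)" using near[of t s] s tJ d(1) by auto
          moreover have "G t - G s - g t * (t - s) = - (G s - G t - g t * (s - t))"
            by (simp add: algebra_simps)
          ultimately show ?thesis using False by simp
        qed
        then show "\<exists>U. open U \<and> t \<in> U \<and>
            (\<forall>s\<in>U \<inter> J. \<bar>G t - G s - g t * (t - s)\<bar> \<le> \<epsilon> * \<bar>t - s\<bar>)"
          using d(1) by (intro exI[of _ "{t - d<..<t + d}"]) auto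
      qed
    qed
  qed
  then show thesis using that unfolding delta_antiderivative_def by blast
qed

section \<open>The Cauchy-Schwarz inequality for covariances\<close>

lemma abs_le_sqrt_mult_sqrt_of_quadratic_form:
  fixes A B C :: real
  assumes nn: "\<And>p q. p\<^sup>2 * A + q\<^sup>2 * B + 2 * p * q * C \<ge> 0"
  shows "\<bar>C\<bar> \<le> sqrt A * sqrt B"
proof -
  have A: "A \<ge> 0" and B: "B \<ge> 0" using nn[of 1 0] nn[of 0 1] by auto
  have "C\<^sup>2 \<le> A * B"
  proof (cases "A = 0")
    case True
    have "C = 0"
    proof (rule ccontr)
      assume "C \<noteq> 0"
      \<comment> \<open>With \<open>A = 0\<close> and \<open>q = 1\<close> the form is affine in
        \<open>p\<close>; this \<open>p\<close> gives it the value -1.\<close>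
      then show False using nn[of "- (B + 1) / (2 * C)" 1] True by (simp add: field_simps)
    qed
    then show ?thesis using True by simp
  next
    case False
    \<comment> \<open>The choice \<open>p = - C\<close>, \<open>q = A\<close> turns the form into
      \<open>A\<close> times the determinant.\<close>
    have "(- C)\<^sup>2 * A + A\<^sup>2 * B + 2 * (- C) * A * C = A * (A * B - C\<^sup>2)"
      by (simp add: power2_eq_square algebra_simps)
    then have "A * (A * B - C\<^sup>2) \<ge> 0" using nn[of "- C" A] by simp
    then show ?thesis using A False by (simp add: zero_le_mult_iff)
  qed
  then have "sqrt (C\<^sup>2) \<le> sqrt (A * B)" by (rule real_sqrt_le_mono)
  then show ?thesis by (simp add: real_sqrt_mult)
qed

lemma delta_integral_covariance_bound:
  assumes T: "closed T" and ab: "a \<in> T" "b \<in> T" "a < b"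
    and k: "delta_integrable T k" and f: "delta_integrable T f"
    and kk: "delta_integrable T (\<lambda>t. (k t)\<^sup>2)" and ff: "delta_integrable T (\<lambda>t. (f t)\<^sup>2)"
    and kf: "delta_integrable T (\<lambda>t. k t * f t)"
  defines "avg \<equiv> \<lambda>g. 1 / (b - a) * delta_integral T a b g"
  shows "\<bar>avg (\<lambda>t. k t * f t) - avg k * avg f\<bar> \<le>
    sqrt (avg (\<lambda>t. (k t)\<^sup>2) - (avg k)\<^sup>2) * sqrt (avg (\<lambda>t. (f t)\<^sup>2) - (avg f)\<^sup>2)"
proof (rule abs_le_sqrt_mult_sqrt_of_quadratic_form)
  fix p q :: real
  obtain K F KK FF KF where
    anti: "delta_pre_antiderivative T k K" "delta_pre_antiderivative T f F"
      "delta_pre_antiderivative T (\<lambda>t. (k t)\<^sup>2) KK" "delta_pre_antiderivative T (\<lambda>t. (f t)\<^sup>2) FF"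
      "delta_pre_antiderivative T (\<lambda>t. k t * f t) KF"
    using k f kk ff kf unfolding delta_integrable_def by metis
  note int = anti[THEN delta_integral_pre_antiderivative[OF T ab(1,2)]]
  \<comment> \<open>This constant gives \<open>p * k t + q * f t + r\<close> mean zero, so its mean
    square is the quadratic form in the variances and the covariance.\<close>
  define r where "r = - (p * avg k + q * avg f)"
  define S where "S t = p\<^sup>2 * KK t + (q\<^sup>2 * FF t + (r\<^sup>2 * t
    + (2 * p * q * KF t + (2 * p * r * K t + 2 * q * r * F t))))" for t
  have "delta_pre_antiderivative T (\<lambda>t. p\<^sup>2 * (k t)\<^sup>2 + (q\<^sup>2 * (f t)\<^sup>2 + (r\<^sup>2
      + (2 * p * q * (k t * f t) + (2 * p * r * k t + 2 * q * r * f t))))) S"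
    unfolding S_def by (intro delta_pre_antiderivative_add delta_pre_antiderivative_cmult
      delta_pre_antiderivative_const anti)
  moreover have "p\<^sup>2 * (k t)\<^sup>2 + (q\<^sup>2 * (f t)\<^sup>2 + (r\<^sup>2
      + (2 * p * q * (k t * f t) + (2 * p * r * k t + 2 * q * r * f t)))) = (p * k t + q * f t + r)\<^sup>2" for t
    by (simp add: power2_eq_square algebra_simps)
  ultimately have "delta_pre_antiderivative T (\<lambda>t. (p * k t + q * f t + r)\<^sup>2) S"
    by (simp only:)
  from delta_pre_antiderivative_nonneg_mono[OF T ab(1,2) less_imp_le[OF ab(3)] this]
  have "S a \<le> S b" by simp
  then have "0 \<le> 1 / (b - a) * (S b - S a)" using ab(3) by simp
  also have "\<dots> = p\<^sup>2 * avg (\<lambda>t. (k t)\<^sup>2) + q\<^sup>2 * avg (\<lambda>t. (f t)\<^sup>2) + r\<^sup>2 * (1 / (b - a) * (b - a))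
      + 2 * p * q * avg (\<lambda>t. k t * f t) + 2 * p * r * avg k + 2 * q * r * avg f"
    unfolding avg_def int S_def by (simp only: algebra_simps)
  also have "1 / (b - a) * (b - a) = 1" using ab(3) by simp
  also have "p\<^sup>2 * avg (\<lambda>t. (k t)\<^sup>2) + q\<^sup>2 * avg (\<lambda>t. (f t)\<^sup>2) + r\<^sup>2 * 1
      + 2 * p * q * avg (\<lambda>t. k t * f t) + 2 * p * r * avg k + 2 * q * r * avg f =
      p\<^sup>2 * (avg (\<lambda>t. (k t)\<^sup>2) - (avg k)\<^sup>2) + q\<^sup>2 * (avg (\<lambda>t. (f t)\<^sup>2) - (avg f)\<^sup>2)
      + 2 * p * q * (avg (\<lambda>t. k t * f t) - avg k * avg f)"
    unfolding r_def by (simp add: power2_eq_square algebra_simps)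
  finally show "0 \<le> p\<^sup>2 * (avg (\<lambda>t. (k t)\<^sup>2) - (avg k)\<^sup>2) + q\<^sup>2 * (avg (\<lambda>t. (f t)\<^sup>2) - (avg f)\<^sup>2)
      + 2 * p * q * (avg (\<lambda>t. k t * f t) - avg k * avg f)" .
qed

section \<open>The Montgomery identity and the resulting inequality\<close>

theorem theorem24:
  fixes T J :: "real set" and a b :: real and \<nu> w f \<psi> :: "real \<Rightarrow> real"
  assumes T: "time_scale T" and ab: "a \<in> T" "b \<in> T" "a < b"
    and J: "J = T \<inter> {a..b}"
    and \<nu>_rd: "rd_continuous J \<nu>" and \<nu>_pos: "\<forall>t\<in>J. \<nu> t > 0"
    and w_diff: "delta_differentiable J w"
    and w_deriv: "\<forall>t\<in>ts_kappa J. delta_deriv J w t = \<nu> t"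
    and f_diff: "delta_differentiable J f"
    and f_sq: "delta_integrable J (\<lambda>t. (delta_deriv J f t)\<^sup>2)"
    and \<psi>: "\<forall>u\<in>{0..1}. \<psi> u \<in> {0..1}"
  shows "\<forall>x\<in>J. \<forall>lam\<in>{0..1}.
    \<bar>((1 + \<psi> (1 - lam) - \<psi> lam) / (2 * (b - a)) * f x
        + (\<psi> lam * f a + (1 - \<psi> (1 - lam)) * f b) / (2 * (b - a)))
          * delta_integral J a b \<nu>
      - 1 / (b - a) * delta_integral J a b (\<lambda>t. \<nu> t * f (fwd_jump J t))
      - (f b - f a) / (b - a)\<^sup>2 * delta_integral J a b (\<lambda>t. kernel_K w \<psi> a b lam t x)\<bar>
    \<le> sqrt (1 / (b - a) * delta_integral J a b (\<lambda>t. (kernel_K w \<psi> a b lam t x)\<^sup>2)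
            - (1 / (b - a) * delta_integral J a b (\<lambda>t. kernel_K w \<psi> a b lam t x))\<^sup>2)
      * sqrt (1 / (b - a) * delta_integral J a b (\<lambda>t. (delta_deriv J f t)\<^sup>2)
            - (1 / (b - a) * delta_integral J a b (delta_deriv J f))\<^sup>2)"
proof (intro ballI)
  fix x lam assume x: "x \<in> J"
  have clJ: "closed J" using T J by (auto simp: time_scale_def)
  have abJ: "a \<in> J" "b \<in> J" "J \<subseteq> {a..b}" using ab J by auto
  have f_anti: "delta_antiderivative J (delta_deriv J f) f"
    using f_diff abJ(1,2) ab(3) by (rule delta_differentiable_antiderivative)
  have w_anti: "delta_antiderivative J \<nu> w"
    using delta_differentiable_antiderivative[OF w_diff abJ(1,2) ab(3)] w_deriv
    by (simp add: delta_antiderivative_def)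
  have f_cont: "continuous_on J f" and w_cont: "continuous_on J w"
    using f_anti[THEN delta_antiderivative_imp_pre] w_anti[THEN delta_antiderivative_imp_pre]
    by (simp_all add: delta_pre_antiderivative_def)
  have rd: "rd_continuous J (\<lambda>t. \<nu> t * f (fwd_jump J t))"
    by (rule rd_continuous_mult[OF \<nu>_rd rd_continuous_compose_fwd_jump[OF clJ f_cont]])
  obtain H where H: "delta_antiderivative J (\<lambda>t. \<nu> t * f (fwd_jump J t)) H"
    using rd_continuous_antiderivative[OF clJ abJ rd] .
  have integrable_cont: "delta_integrable J g" if "continuous_on J g" for g
    using rd_continuous_antiderivative[OF clJ abJ continuous_on_imp_rd_continuous[OF that]]
      delta_antiderivative_imp_pre unfolding delta_integrable_def by blast
  have integrable_glue: "delta_integrable J (\<lambda>s. if s < x then g s else h s)"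
    if "delta_integrable J g" "delta_integrable J h" for g h
    using that delta_pre_antiderivative_glue[OF clJ x] unfolding delta_integrable_def by blast
  define c1 where "c1 = w a + \<psi> lam * ((w b - w a) / 2)"
  define c2 where "c2 = w a + (1 + \<psi> (1 - lam)) * ((w b - w a) / 2)"
  let ?K = "\<lambda>t. kernel_K w \<psi> a b lam t x" and ?D = "delta_deriv J f"
  have K: "?K t = (if t < x then w t - c1 else w t - c2)" for t
    by (simp add: kernel_K_def c1_def c2_def)
  have K_eq: "?K = (\<lambda>t. if t < x then w t - c1 else w t - c2)"
    and KK_eq: "(\<lambda>t. (?K t)\<^sup>2) = (\<lambda>t. if t < x then (w t - c1)\<^sup>2 else (w t - c2)\<^sup>2)"
    and KD_eq: "(\<lambda>t. ?K t * ?D t) = (\<lambda>t. if t < x then (w t - c1) * ?D t else (w t - c2) * ?D t)"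
    by (auto simp: K)
  have K_int: "delta_integrable J ?K"
    unfolding K_eq by (intro integrable_glue integrable_cont continuous_intros w_cont)
  have KK_int: "delta_integrable J (\<lambda>t. (?K t)\<^sup>2)"
    unfolding KK_eq by (intro integrable_glue integrable_cont continuous_intros w_cont)
  have D_int: "delta_integrable J ?D"
    using f_anti delta_antiderivative_imp_pre unfolding delta_integrable_def by blast
  \<comment> \<open>The product rule for \<open>(w - c) * f\<close> yields the integrand plus
    \<open>\<nu> t * f (fwd_jump J t)\<close>; subtracting \<open>H\<close> removes the
    latter.\<close>
  have by_parts: "delta_pre_antiderivative J (\<lambda>t. (w t - c) * ?D t) (\<lambda>t. (w t - c) * f t + - 1 * H t)" for c
  proof -
    have "has_delta_derivative J (\<lambda>t. (w t - c) * f t + - 1 * H t) ((w t - c) * ?D t) t"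
      if t: "t \<in> ts_kappa J" for t
    proof -
      have tJ: "t \<in> J" using t by (simp add: ts_kappa_def)
      have "has_delta_derivative J w (\<nu> t) t" "has_delta_derivative J f (?D t) t"
        "has_delta_derivative J H (\<nu> t * f (fwd_jump J t)) t"
        using t w_anti f_anti H by (auto simp: delta_antiderivative_def)
      note d = this
      have wc: "has_delta_derivative J (\<lambda>t. w t - c) (\<nu> t) t"
        using has_delta_derivative_diff[OF d(1) has_delta_derivative_const] by simp
      show ?thesis
        using has_delta_derivative_diff[OF has_delta_derivative_mult[OF wc d(2) tJ] d(3)] by simp
    qed
    then show ?thesis
      by (intro delta_antiderivative_imp_pre) (simp add: delta_antiderivative_def)
  qed
  note KD_anti = delta_pre_antiderivative_glue[OF clJ x by_parts[of c1] by_parts[of c2], folded KD_eq]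
  then have KD_int: "delta_integrable J (\<lambda>t. ?K t * ?D t)"
    unfolding delta_integrable_def by blast
  have int_\<nu>: "delta_integral J a b \<nu> = w b - w a"
    using delta_integral_antiderivative[OF clJ abJ(1,2) w_anti] .
  have int_H: "delta_integral J a b (\<lambda>t. \<nu> t * f (fwd_jump J t)) = H b - H a"
    using delta_integral_antiderivative[OF clJ abJ(1,2) H] .
  have int_D: "delta_integral J a b ?D = f b - f a"
    using delta_integral_antiderivative[OF clJ abJ(1,2) f_anti] .
  \<comment> \<open>The term with \<open>f x\<close> is the shift made in gluing: the two
    antiderivatives differ by \<open>(c2 - c1) * f x\<close> at \<open>x\<close>. For
    \<open>x = b\<close> the endpoint \<open>b\<close> falls in the first branch, with the same
    result.\<close>
  have int_KD: "delta_integral J a b (\<lambda>t. ?K t * ?D t) =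
      (w b - c2) * f b - (w a - c1) * f a + (c2 - c1) * f x - (H b - H a)"
    using delta_integral_pre_antiderivative[OF clJ abJ(1,2) KD_anti] x abJ
    by (cases "x = b") (auto simp: algebra_simps)
  have coeffs: "w b - c2 = (1 - \<psi> (1 - lam)) * (w b - w a) / 2" "w a - c1 = - \<psi> lam * (w b - w a) / 2"
    "c2 - c1 = (1 + \<psi> (1 - lam) - \<psi> lam) * (w b - w a) / 2"
    by (simp_all add: c1_def c2_def field_simps)
  have regroup: "((1 + p - q) / (2 * L) * X + (q * A + (1 - p) * B) / (2 * L)) * W
      - 1 / L * E - (B - A) / L\<^sup>2 * I
    = 1 / L * ((1 - p) * W / 2 * B - - q * W / 2 * A + (1 + p - q) * W / 2 * X - E)
      - 1 / L * I * (1 / L * (B - A))" if "L \<noteq> 0" for p q L X A B W E I :: real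
    using that by (simp add: field_simps power2_eq_square)
  define I where "I = delta_integral J a b ?K"
  \<comment> \<open>The expression to be estimated is the mean of \<open>?K * ?D\<close> minus the
    product of the means.\<close>
  have "((1 + \<psi> (1 - lam) - \<psi> lam) / (2 * (b - a)) * f x
        + (\<psi> lam * f a + (1 - \<psi> (1 - lam)) * f b) / (2 * (b - a))) * delta_integral J a b \<nu>
      - 1 / (b - a) * delta_integral J a b (\<lambda>t. \<nu> t * f (fwd_jump J t))
      - (f b - f a) / (b - a)\<^sup>2 * I
    = 1 / (b - a) * delta_integral J a b (\<lambda>t. ?K t * ?D t)
      - 1 / (b - a) * I * (1 / (b - a) * delta_integral J a b ?D)"
    unfolding int_KD int_\<nu> int_H int_D coeffs using ab(3) by (intro regroup) simp
  then show "\<bar>((1 + \<psi> (1 - lam) - \<psi> lam) / (2 * (b - a)) * f x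
        + (\<psi> lam * f a + (1 - \<psi> (1 - lam)) * f b) / (2 * (b - a)))
          * delta_integral J a b \<nu>
      - 1 / (b - a) * delta_integral J a b (\<lambda>t. \<nu> t * f (fwd_jump J t))
      - (f b - f a) / (b - a)\<^sup>2 * delta_integral J a b ?K\<bar>
    \<le> sqrt (1 / (b - a) * delta_integral J a b (\<lambda>t. (?K t)\<^sup>2)
            - (1 / (b - a) * delta_integral J a b ?K)\<^sup>2)
      * sqrt (1 / (b - a) * delta_integral J a b (\<lambda>t. (?D t)\<^sup>2)
            - (1 / (b - a) * delta_integral J a b ?D)\<^sup>2)"
    \<comment> \<open>Of the five integrability conditions only that on the square of
      \<open>?D\<close> is assumed, as \<open>f_sq\<close>; the others were derived above.\<close>
    using delta_integral_covariance_bound[OF clJ abJ(1,2) ab(3) K_int D_int KK_int f_sq KD_int]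
    unfolding I_def by simp
qed

end
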